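(* Let $G$ be a locally finite Borel graph on a standard Borel space $X$ such that every connected component of $G$ is quasi-transitive and amenable, and suppose $G$ admits a fractional perfect matching. Then $G$ admits a Borel fractional perfect matching.
   Context: A countable locally finite graph is quasi-transitive if the action of its automorphism group on its vertex set has only finitely many orbits. A countable locally finite graph is amenable if $\inf\{|\partial S|/|S| : S \text{ a finite nonempty connected set of vertices}\} = 0$, where $\partial S$ is the set of vertices outside $S$ adjacent to some vertex of $S$. A fractional perfect matching of a graph $G=(V,E)$ is a symmetric function $f:E\to[0,1]$ with $\sum_{e \ni v} f(e) = 1$ for every vertex $v$ (the sum over edges incident to $v$). It is a Borel fractional perfect matching if $f$ is a Borel function on the (standard Borel) edge set $E$. *)

theory Defs
  imports "HOL-Analysis.Analysis" "HOL-Algebra.Group_Action"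
begin

text \<open>
  A simple undirected graph on a vertex set \<open>V\<close> is given by its set \<open>E \<subseteq> V \<times> V\<close> of ordered
  adjacent pairs, a symmetric irreflexive relation; an undirected edge is thus represented by two
  pairs, and a function on edges by a function on \<open>E\<close> that is invariant under swapping.
\<close>

definition neighbours :: "('a \<times> 'a) set \<Rightarrow> 'a \<Rightarrow> 'a set" where
  "neighbours E x = {y. (x, y) \<in> E}"

definition locally_finite_graph :: "'a set \<Rightarrow> ('a \<times> 'a) set \<Rightarrow> bool" where
  "locally_finite_graph V E \<longleftrightarrow> (\<forall>x\<in>V. finite (neighbours E x))"

definition graph_component :: "('a \<times> 'a) set \<Rightarrow> 'a \<Rightarrow> 'a set" where
  "graph_component E x = {y. (x, y) \<in> E\<^sup>*}"

definition connected_vertex_set :: "('a \<times> 'a) set \<Rightarrow> 'a set \<Rightarrow> bool" where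
  "connected_vertex_set E S \<longleftrightarrow> (\<forall>x\<in>S. \<forall>y\<in>S. (x, y) \<in> (E \<inter> S \<times> S)\<^sup>*)"

definition graph_automorphisms :: "'a set \<Rightarrow> ('a \<times> 'a) set \<Rightarrow> ('a \<Rightarrow> 'a) set" where
  "graph_automorphisms V E =
     {\<phi> \<in> Bij V. \<forall>x\<in>V. \<forall>y\<in>V. (\<phi> x, \<phi> y) \<in> E \<longleftrightarrow> (x, y) \<in> E}"

definition graph_automorphism_group :: "'a set \<Rightarrow> ('a \<times> 'a) set \<Rightarrow> ('a \<Rightarrow> 'a) monoid" where
  "graph_automorphism_group V E = (BijGroup V)\<lparr>carrier := graph_automorphisms V E\<rparr>"

text \<open>
  Quasi-transitivity and amenability are only meant for countable locally finite graphs; every connected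
  component of a locally finite graph is of this kind.
\<close>

definition quasi_transitive_graph :: "'a set \<Rightarrow> ('a \<times> 'a) set \<Rightarrow> bool" where
  "quasi_transitive_graph V E \<longleftrightarrow>
     finite (orbits (graph_automorphism_group V E) V (\<lambda>\<phi>. \<phi>))"

definition outer_vertex_boundary :: "'a set \<Rightarrow> ('a \<times> 'a) set \<Rightarrow> 'a set \<Rightarrow> 'a set" where
  "outer_vertex_boundary V E S = {y \<in> V - S. \<exists>x\<in>S. (x, y) \<in> E}"

definition amenable_graph :: "'a set \<Rightarrow> ('a \<times> 'a) set \<Rightarrow> bool" where
  "amenable_graph V E \<longleftrightarrow>
     (INF S\<in>{S. S \<subseteq> V \<and> finite S \<and> S \<noteq> {} \<and> connected_vertex_set E S}.
        real (card (outer_vertex_boundary V E S)) / real (card S)) = 0"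

definition standard_borel_space :: "'a measure \<Rightarrow> bool" where
  "standard_borel_space M \<longleftrightarrow>
     (\<exists>T. topspace T = space M \<and> completely_metrizable_space T \<and> separable_space T \<and>
          sets M = sigma_sets (space M) {U. openin T U})"

definition borel_graph :: "'a measure \<Rightarrow> ('a \<times> 'a) set \<Rightarrow> bool" where
  "borel_graph M E \<longleftrightarrow> E \<in> sets (M \<Otimes>\<^sub>M M) \<and> sym E \<and> irrefl E"

definition fractional_perfect_matching ::
    "'a set \<Rightarrow> ('a \<times> 'a) set \<Rightarrow> ('a \<times> 'a \<Rightarrow> real) \<Rightarrow> bool" where
  "fractional_perfect_matching V E f \<longleftrightarrow>
     f \<in> E \<rightarrow> {0..1} \<and>
     (\<forall>(x, y)\<in>E. f (x, y) = f (y, x)) \<and>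
     (\<forall>x\<in>V. (\<Sum>y\<in>neighbours E x. f (x, y)) = 1)"

definition borel_fractional_perfect_matching ::
    "'a measure \<Rightarrow> ('a \<times> 'a) set \<Rightarrow> ('a \<times> 'a \<Rightarrow> real) \<Rightarrow> bool" where
  "borel_fractional_perfect_matching M E f \<longleftrightarrow>
     fractional_perfect_matching (space M) E f \<and>
     f \<in> borel_measurable (restrict_space (M \<Otimes>\<^sub>M M) E)"

lemma group_action_graph_automorphism_group:
  "group_action (graph_automorphism_group V E) V (\<lambda>\<phi>. \<phi>)"
proof -
  have "subgroup (graph_automorphisms V E) (BijGroup V)"
  proof (rule group.subgroupI[OF group_BijGroup])
    show "graph_automorphisms V E \<subseteq> carrier (BijGroup V)"
      by (auto simp: graph_automorphisms_def BijGroup_def)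
    have "(\<lambda>x\<in>V. x) \<in> graph_automorphisms V E"
      by (auto simp: graph_automorphisms_def id_Bij)
    then show "graph_automorphisms V E \<noteq> {}" by blast
  next
    fix a assume a: "a \<in> graph_automorphisms V E"
    then have aB: "a \<in> Bij V" and b: "bij_betw a V V"
      by (auto simp: graph_automorphisms_def Bij_def)
    have "(inv_into V a x, inv_into V a y) \<in> E \<longleftrightarrow> (x, y) \<in> E" if "x \<in> V" "y \<in> V" for x y
    proof -
      have "inv_into V a x \<in> V" "inv_into V a y \<in> V"
        using that aB by (auto intro: Bij_inv_into_mem)
      then show ?thesis
        using a that b by (simp add: graph_automorphisms_def)
          (metis bij_betw_inv_into_right)
    qed
    then show "inv\<^bsub>BijGroup V\<^esub> a \<in> graph_automorphisms V E"
      using aB by (simp add: inv_BijGroup graph_automorphisms_def restrict_inv_into_Bij)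
  next
    fix a b assume ab: "a \<in> graph_automorphisms V E" "b \<in> graph_automorphisms V E"
    then have "b x \<in> V" if "x \<in> V" for x
      using that by (auto simp: graph_automorphisms_def dest: Bij_imp_funcset)
    with ab show "a \<otimes>\<^bsub>BijGroup V\<^esub> b \<in> graph_automorphisms V E"
      by (simp add: graph_automorphisms_def BijGroup_def compose_Bij compose_eq)
  qed
  then have "group (graph_automorphism_group V E)"
    unfolding graph_automorphism_group_def
    using group.subgroup_imp_group group_BijGroup by blast
  then show ?thesis
    using group_BijGroup[of V]
    by (auto simp: group_action_def group_hom_def group_hom_axioms_def hom_def
        graph_automorphism_group_def graph_automorphisms_def BijGroup_def)
qed

end

theory Submission
  imports Defs
begin

text \<open>
  Colour refinement replaces automorphism groups. Let every vertex start with the same colour and repeatedly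
  refine its colour by the multiset of colours of its neighbours. Automorphisms preserve colours,
  so on a quasi-transitive component there are boundedly many colours, and some stage \<open>r\<close> is
  stable there: the number \<open>d i j\<close> of neighbours of colour \<open>j\<close> of a vertex of colour \<open>i\<close> is well
  defined. Averaging a given fractional perfect matching over the edges from colour \<open>i\<close> to colour
  \<open>j\<close> along a Folner sequence yields in the limit a symmetric fractional perfect matching that
  depends only on the colours of the end points.

  The existence of such a matching at stage \<open>r\<close> only depends on the finite set of colours of stage
  \<open>r + 1\<close> occurring in the component. There are only countably many such sets, so choosing the least
  suitable stage and one matching for each set of colours gives a Borel function, provided that
  counting the neighbours in a Borel set is a Borel operation. The latter is the Lusin--Novikov theorem for
  relations with finite sections. It is derived from Novikov's separation theorem for analytic
  sets, after coding a standard Borel space in the Baire space.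
\<close>

section \<open>Analytic sets\<close>

lemma open_vimage_coordinate: "open W \<Longrightarrow> open ((\<lambda>z :: 'a \<Rightarrow> 'b::topological_space. z i) -` W)"
  by (intro open_vimage continuous_on_product_coordinates)

text \<open>
  The library declares functions to be Hausdorff only for metric codomains and countable domains,
  which excludes \<open>nat \<Rightarrow> nat\<close>. Generalising that arity has to follow the class hierarchy.
\<close>

instance "fun" :: (type, t0_space) t0_space
proof
  fix x y :: "'a \<Rightarrow> 'b" assume "x \<noteq> y"
  then obtain i where i: "x i \<noteq> y i" by auto
  obtain U where "open U" "\<not> (x i \<in> U \<longleftrightarrow> y i \<in> U)"
    using t0_space_class.t0_space[OF i] by blast
  then show "\<exists>U. open U \<and> \<not> (x \<in> U \<longleftrightarrow> y \<in> U)"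
    using open_vimage_coordinate[of U i] by (intro exI[of _ "(\<lambda>z. z i) -` U"]) auto
qed

instance "fun" :: (type, t1_space) t1_space
proof
  fix x y :: "'a \<Rightarrow> 'b" assume "x \<noteq> y"
  then obtain i where i: "x i \<noteq> y i" by auto
  obtain U where "open U" "x i \<in> U" "y i \<notin> U"
    using t1_space_class.t1_space[OF i] by blast
  then show "\<exists>U. open U \<and> x \<in> U \<and> y \<notin> U"
    using open_vimage_coordinate[of U i] by (intro exI[of _ "(\<lambda>z. z i) -` U"]) auto
qed

instance "fun" :: (type, t2_space) t2_space
proof
  fix x y :: "'a \<Rightarrow> 'b" assume "x \<noteq> y"
  then obtain i where i: "x i \<noteq> y i" by auto
  obtain U V where "open U" "open V" "x i \<in> U" "y i \<in> V" "U \<inter> V = {}"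
    using hausdorff[OF i] by blast
  then show "\<exists>U V. open U \<and> open V \<and> x \<in> U \<and> y \<in> V \<and> U \<inter> V = {}"
    using open_vimage_coordinate[of U i] open_vimage_coordinate[of V i]
    by (intro exI[of _ "(\<lambda>z. z i) -` U"] exI[of _ "(\<lambda>z. z i) -` V"]) auto
qed

text \<open>Since \<open>F\<close> may be empty, the empty set is included. Continuity of
  \<open>f\<close> is demanded on the whole Baire space, so that maps compose without tracking
  domains.\<close>

definition analytic_set :: "'b::topological_space set \<Rightarrow> bool" where
  "analytic_set A \<longleftrightarrow>
     (\<exists>F f. closed (F :: (nat \<Rightarrow> nat) set) \<and> continuous_on UNIV f \<and> A = f ` F)"

lemma analytic_setI:
  "closed (F :: (nat \<Rightarrow> nat) set) \<Longrightarrow> continuous_on UNIV f \<Longrightarrow> A = f ` F \<Longrightarrow> analytic_set A"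
  unfolding analytic_set_def by blast

lemma analytic_set_image:
  assumes "analytic_set A" "continuous_on UNIV g"
  shows "analytic_set (g ` A)"
proof -
  obtain F f where "closed (F :: (nat \<Rightarrow> nat) set)" "continuous_on UNIV f" "A = f ` F"
    using assms(1) unfolding analytic_set_def by blast
  with assms(2) show ?thesis
    by (intro analytic_setI[of F "\<lambda>u. g (f u)"]) (auto simp: image_image intro: continuous_on_compose2)
qed

lemma analytic_set_closed: "closed A \<Longrightarrow> analytic_set (A :: (nat \<Rightarrow> nat) set)"
  by (rule analytic_setI[where f = "\<lambda>x. x"]) (auto intro: continuous_intros)

lemma continuous_on_rearrange:
  "continuous_on UNIV (\<lambda>u :: nat \<Rightarrow> 'b::topological_space. \<lambda>k. u (h k))"
  by (intro continuous_on_coordinatewise_then_product continuous_on_product_coordinates)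

text \<open>The first entry of a sequence selects a member of the family, and the shifted sequence
  codes a point of that member.\<close>

lemma analytic_set_Union:
  fixes A :: "nat \<Rightarrow> 'b::topological_space set"
  assumes "\<And>i. analytic_set (A i)"
  shows "analytic_set (\<Union>i. A i)"
proof -
  obtain F f where F: "\<And>i. closed (F i :: (nat \<Rightarrow> nat) set)"
    and f: "\<And>i. continuous_on UNIV (f i)" and A: "\<And>i. A i = f i ` F i"
    using assms unfolding analytic_set_def by metis
  define sh :: "(nat \<Rightarrow> nat) \<Rightarrow> nat \<Rightarrow> nat" where "sh u = (\<lambda>k. u (Suc k))" for u
  have sh: "continuous_on UNIV sh"
    unfolding sh_def by (rule continuous_on_rearrange)
  have op: "open {u :: nat \<Rightarrow> nat. u 0 = i}" for i
  proof -
    have "{u :: nat \<Rightarrow> nat. u 0 = i} = (\<lambda>u. u 0) -` {i}" by auto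
    then show ?thesis
      using open_vimage[OF open_discrete continuous_on_product_coordinates] by metis
  qed
  have cont: "continuous_on UNIV (\<lambda>u. f (u 0) (sh u))"
  proof -
    \<comment> \<open>Fixing the first entry gives open pieces, on each of which the map is a single
      \<open>f i\<close> after the shift.\<close>
    have "continuous_on (\<Union>i. {u :: nat \<Rightarrow> nat. u 0 = i}) (\<lambda>u. f (u 0) (sh u))"
    proof (rule continuous_on_open_UN)
      fix i
      have "continuous_on {u :: nat \<Rightarrow> nat. u 0 = i} (\<lambda>u. f i (sh u))"
        using continuous_on_compose2[OF f sh] continuous_on_subset by blast
      then show "continuous_on {u :: nat \<Rightarrow> nat. u 0 = i} (\<lambda>u. f (u 0) (sh u))"
        by (rule continuous_on_eq) auto
    qed (rule op)
    moreover have "(\<Union>i. {u :: nat \<Rightarrow> nat. u 0 = i}) = UNIV" by auto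
    ultimately show ?thesis by simp
  qed
  have "{u. sh u \<in> F (u 0)} = (\<Inter>i. - {u. u 0 = i} \<union> sh -` F i)" by auto
  then have cl: "closed {u. sh u \<in> F (u 0)}"
    using op F sh by (auto intro!: closed_INT closed_Un closed_vimage)
  have "(\<Union>i. A i) = (\<lambda>u. f (u 0) (sh u)) ` {u. sh u \<in> F (u 0)}"
  proof (intro Set.set_eqI iffI)
    fix x assume "x \<in> (\<Union>i. A i)"
    then obtain i u where "u \<in> F i" "x = f i u" unfolding A by auto
    moreover have "sh (case_nat i u) = u" by (simp add: sh_def)
    ultimately show "x \<in> (\<lambda>u. f (u 0) (sh u)) ` {u. sh u \<in> F (u 0)}"
      by (intro image_eqI[of _ _ "case_nat i u"]) auto
  qed (auto simp: A)
  with cl cont show ?thesis by (intro analytic_setI)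
qed

text \<open>One sequence codes countably many sequences, its rows; row \<open>i\<close> names a
  point of \<open>A i\<close>. That all rows name the same point is a closed condition because the
  target is Hausdorff.\<close>

lemma analytic_set_Inter:
  fixes A :: "nat \<Rightarrow> 'b::t2_space set"
  assumes "\<And>i. analytic_set (A i)"
  shows "analytic_set (\<Inter>i. A i)"
proof -
  obtain F f where F: "\<And>i. closed (F i :: (nat \<Rightarrow> nat) set)"
    and f: "\<And>i. continuous_on UNIV (f i)" and A: "\<And>i. A i = f i ` F i"
    using assms unfolding analytic_set_def by metis
  define row :: "nat \<Rightarrow> (nat \<Rightarrow> nat) \<Rightarrow> nat \<Rightarrow> nat" where "row i u = (\<lambda>k. u (prod_encode (i, k)))" for i u
  have row: "continuous_on UNIV (row i)" for i
    unfolding row_def by (rule continuous_on_rearrange)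
  have cont: "continuous_on UNIV (\<lambda>u. f i (row i u))" for i
    using continuous_on_compose2[OF f row] by blast
  define G where "G = {u. \<forall>i. row i u \<in> F i \<and> f i (row i u) = f 0 (row 0 u)}"
  have "G = (\<Inter>i. row i -` F i \<inter> {u. f i (row i u) = f 0 (row 0 u)})"
    unfolding G_def by auto
  then have cl: "closed G"
    using F row cont by (auto intro!: closed_INT closed_Int closed_vimage closed_Collect_eq)
  have "(\<Inter>i. A i) = (\<lambda>u. f 0 (row 0 u)) ` G"
  proof (intro Set.set_eqI iffI)
    fix x assume "x \<in> (\<Inter>i. A i)"
    then have "\<forall>i. \<exists>u. u \<in> F i \<and> x = f i u" unfolding A by auto
    then obtain u where u: "\<And>i. u i \<in> F i" "\<And>i. x = f i (u i)" by metis
    define v where "v n = u (fst (prod_decode n)) (snd (prod_decode n))" for n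
    have "row i v = u i" for i by (simp add: row_def v_def)
    with u show "x \<in> (\<lambda>u. f 0 (row 0 u)) ` G"
      by (intro image_eqI[of _ _ v]) (auto simp: G_def)
  next
    fix x assume "x \<in> (\<lambda>u. f 0 (row 0 u)) ` G"
    then obtain u where u: "\<And>i. row i u \<in> F i" "\<And>i. f i (row i u) = f 0 (row 0 u)"
      and x: "x = f 0 (row 0 u)"
      unfolding G_def by auto
    have "x \<in> f i ` F i" for i
      using u[of i] x by (intro image_eqI[of _ _ "row i u"]) auto
    then show "x \<in> (\<Inter>i. A i)" unfolding A by blast
  qed
  with cl cont show ?thesis by (intro analytic_setI)
qed

lemma analytic_set_Un: "analytic_set A \<Longrightarrow> analytic_set B \<Longrightarrow> analytic_set (A \<union> B)"
proof -
  assume "analytic_set A" "analytic_set B"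
  then have "analytic_set (\<Union>i::nat. if i = 0 then A else B)"
    by (intro analytic_set_Union) auto
  moreover have "(\<Union>i::nat. if i = 0 then A else B) = A \<union> B"
    by (rule Set.set_eqI) (simp, metis zero_neq_one)
  ultimately show ?thesis by simp
qed

text \<open>The even entries of a sequence code a point of \<open>A\<close>, the odd entries a point
  of \<open>B\<close>.\<close>

lemma analytic_set_Times:
  assumes "analytic_set A" "analytic_set B"
  shows "analytic_set (A \<times> B)"
proof -
  obtain F f where F: "closed (F :: (nat \<Rightarrow> nat) set)" "continuous_on UNIV f" "A = f ` F"
    using assms(1) unfolding analytic_set_def by blast
  obtain G g where G: "closed (G :: (nat \<Rightarrow> nat) set)" "continuous_on UNIV g" "B = g ` G"
    using assms(2) unfolding analytic_set_def by blast
  define ev od :: "(nat \<Rightarrow> nat) \<Rightarrow> nat \<Rightarrow> nat"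
    where "ev u = (\<lambda>k. u (2 * k))" and "od u = (\<lambda>k. u (2 * k + 1))" for u
  have cont: "continuous_on UNIV ev" "continuous_on UNIV od"
    unfolding ev_def od_def by (rule continuous_on_rearrange)+
  have "A \<times> B = (\<lambda>u. (f (ev u), g (od u))) ` (ev -` F \<inter> od -` G)"
  proof (intro Set.set_eqI iffI)
    fix p assume "p \<in> A \<times> B"
    then obtain u v where uv: "u \<in> F" "v \<in> G" "p = (f u, g v)" unfolding F G by auto
    define w where "w n = (if even n then u (n div 2) else v (n div 2))" for n
    have "ev w = u" "od w = v" by (auto simp: ev_def od_def w_def)
    with uv show "p \<in> (\<lambda>u. (f (ev u), g (od u))) ` (ev -` F \<inter> od -` G)"
      by (intro image_eqI[of _ _ w]) auto
  qed (fastforce simp: F(3) G(3))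
  moreover have "continuous_on UNIV (\<lambda>u. (f (ev u), g (od u)))"
  proof (rule continuous_on_Pair)
    show "continuous_on UNIV (\<lambda>u. f (ev u))"
      by (rule continuous_on_compose2[OF F(2) cont(1)]) simp
    show "continuous_on UNIV (\<lambda>u. g (od u))"
      by (rule continuous_on_compose2[OF G(2) cont(2)]) simp
  qed
  moreover have "closed (ev -` F \<inter> od -` G)"
    by (intro closed_Int closed_vimage F G cont)
  ultimately show ?thesis by (intro analytic_setI)
qed

text \<open>The sets that are analytic together with their complements form a sigma-algebra.
  Carrying both properties through the induction is what handles complements.\<close>

lemma analytic_set_sigma_sets:
  fixes \<G> :: "'b::t2_space set set"
  assumes UNIV: "analytic_set (UNIV :: 'b set)"
    and gen: "\<And>A. A \<in> \<G> \<Longrightarrow> analytic_set A \<and> analytic_set (- A)"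
    and A: "A \<in> sigma_sets UNIV \<G>"
  shows "analytic_set A"
proof -
  have "analytic_set A \<and> analytic_set (- A)"
    using A
  proof induction
    case Empty
    have "analytic_set ({} :: 'b set)" by (rule analytic_setI[of "{}" "\<lambda>_. undefined"]) auto
    with UNIV show ?case by simp
  next
    case (Union A)
    then show ?case by (auto intro!: analytic_set_Union analytic_set_Inter)
  qed (auto simp: gen Compl_eq_Diff_UNIV[symmetric])
  then show ?thesis ..
qed

text \<open>The generators restrict a single coordinate, hence are clopen, so that they and their
  complements are analytic.\<close>

lemma analytic_set_borel_Baire:
  assumes "A \<in> sets (borel :: (nat \<Rightarrow> nat) measure)"
  shows "analytic_set A"
proof -
  have "sets (borel :: (nat \<Rightarrow> nat) measure) = sets (Pi\<^sub>M UNIV (\<lambda>_. borel))"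
    by (rule sets_PiM_equal_borel[symmetric])
  also have "\<dots> = sets (Pi\<^sub>M UNIV (\<lambda>_. count_space UNIV))"
    by (intro sets_PiM_cong refl sets_borel_eq_count_space)
  also have "\<dots> = sigma_sets UNIV {{x :: nat \<Rightarrow> nat. x i \<in> J} | i J. True}"
    unfolding sets_PiM_single by (simp add: PiE_UNIV_domain)
  finally have "A \<in> sigma_sets UNIV {{x :: nat \<Rightarrow> nat. x i \<in> J} | i J. True}"
    using assms by blast
  then show ?thesis
  proof (rule analytic_set_sigma_sets[rotated 2])
    fix B assume "B \<in> {{x :: nat \<Rightarrow> nat. x i \<in> J} | i J. True}"
    then obtain i J where "B = (\<lambda>x. x i) -` J" by auto
    then have "open B" "open (- B)"
      using open_vimage_coordinate[OF open_discrete] by (auto simp: vimage_Compl[symmetric])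
    then have "closed B" "closed (- B)" by (auto simp: closed_def)
    then show "analytic_set B \<and> analytic_set (- B)"
      by (auto intro: analytic_set_closed)
  qed (auto intro: analytic_set_closed)
qed

text \<open>The complement of a Borel rectangle is a union of two Borel rectangles, so the
  generators meet the conditions of \<open>analytic_set_sigma_sets\<close>.\<close>

lemma analytic_set_borel_prod:
  fixes A :: "('b::{second_countable_topology,t2_space} \<times> 'c::{second_countable_topology,t2_space}) set"
  assumes B: "\<And>B :: 'b set. B \<in> sets borel \<Longrightarrow> analytic_set B"
    and C: "\<And>C :: 'c set. C \<in> sets borel \<Longrightarrow> analytic_set C"
    and A: "A \<in> sets borel"
  shows "analytic_set A"
proof -
  have "A \<in> sigma_sets UNIV {B \<times> C | B C. B \<in> sets (borel :: 'b measure) \<and> C \<in> sets (borel :: 'c measure)}"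
    using A unfolding borel_prod[symmetric] sets_pair_measure by simp
  then show ?thesis
  proof (rule analytic_set_sigma_sets[rotated 2])
    show "analytic_set (UNIV :: ('b \<times> 'c) set)"
      using analytic_set_Times[OF B C, of UNIV UNIV] by simp
    fix D assume "D \<in> {B \<times> C | B C. B \<in> sets (borel :: 'b measure) \<and> C \<in> sets (borel :: 'c measure)}"
    then obtain P Q where D: "D = P \<times> Q" and PQ: "P \<in> sets borel" "Q \<in> sets borel" by auto
    have "- D = (- P) \<times> UNIV \<union> UNIV \<times> (- Q)" unfolding D by auto
    then show "analytic_set D \<and> analytic_set (- D)"
      unfolding D using PQ by (auto intro!: analytic_set_Un analytic_set_Times B C)
  qed
qed

section \<open>Novikov separation\<close>

definition borel_separable :: "(nat \<Rightarrow> 'b::topological_space set) \<Rightarrow> bool" where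
  "borel_separable A \<longleftrightarrow> (\<exists>B. (\<forall>i. B i \<in> sets borel \<and> A i \<subseteq> B i) \<and> (\<Inter>i. B i) = {})"

lemma borel_separableI:
  "(\<And>i. B i \<in> sets borel) \<Longrightarrow> (\<And>i. A i \<subseteq> B i) \<Longrightarrow> (\<Inter>i. B i) = {} \<Longrightarrow> borel_separable A"
  unfolding borel_separable_def by blast

text \<open>Every other member is enlarged to \<open>UNIV\<close>; the intersection is then
  contained in \<open>U \<inter> V\<close>.\<close>

lemma borel_separable_pair:
  assumes "U \<in> sets borel" "V \<in> sets borel" "U \<inter> V = {}" "i \<noteq> j" "A i \<subseteq> U" "A j \<subseteq> V"
  shows "borel_separable A"
proof (rule borel_separableI)
  fix k show "(if k = i then U else if k = j then V else UNIV) \<in> sets borel" using assms by simp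
next
  fix k show "A k \<subseteq> (if k = i then U else if k = j then V else UNIV)" using assms by simp
next
  have "(\<Inter>k. if k = i then U else if k = j then V else UNIV) \<subseteq> U \<inter> V"
  proof
    fix x assume x: "x \<in> (\<Inter>k. if k = i then U else if k = j then V else UNIV)"
    have "x \<in> U" using INT_D[OF x, of i] by simp
    moreover have "x \<in> V" using INT_D[OF x, of j] assms(4) by simp
    ultimately show "x \<in> U \<inter> V" ..
  qed
  with assms(3) show "(\<Inter>k. if k = i then U else if k = j then V else UNIV) = {}" by blast
qed

text \<open>From Borel enlargements for each piece \<open>C k\<close>, take the union over
  \<open>k\<close> at index \<open>i\<close> and the intersection over \<open>k\<close> elsewhere.
  Read contrapositively, a nonseparable family stays nonseparable for some piece, which drives the
  proof of Novikov's theorem.\<close>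

lemma borel_separable_split:
  fixes A :: "nat \<Rightarrow> 'b::topological_space set"
  assumes "A i \<subseteq> (\<Union>k::nat. C k)" and "\<And>k. borel_separable (A(i := C k))"
  shows "borel_separable A"
proof -
  obtain B where B: "\<And>k j. B k j \<in> sets borel" "\<And>k j. (A(i := C k)) j \<subseteq> B k j"
    and B0: "\<And>k. (\<Inter>j. B k j) = {}"
    using assms(2) unfolding borel_separable_def by metis
  define D where "D j = (if j = i then (\<Union>k. B k i) else (\<Inter>k. B k j))" for j
  show ?thesis
  proof (rule borel_separableI)
    fix j show "D j \<in> sets borel" using B(1) by (auto simp: D_def)
  next
    fix j show "A j \<subseteq> D j"
    proof (cases "j = i")
      case True
      have "C k \<subseteq> B k i" for k using B(2)[of k i] by simp
      then have "(\<Union>k. C k) \<subseteq> (\<Union>k. B k i)" by (intro UN_mono) auto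
      with assms(1) have "A i \<subseteq> (\<Union>k. B k i)" by (rule subset_trans)
      with True show ?thesis by (simp add: D_def)
    next
      case False
      then have "A j \<subseteq> B k j" for k using B(2)[of k j] by simp
      with False show ?thesis unfolding D_def by auto
    qed
  next
    show "(\<Inter>j. D j) = {}"
    proof (rule equals0I)
      fix x assume x: "x \<in> (\<Inter>j. D j)"
      then have "x \<in> D i" by blast
      then obtain k where k: "x \<in> B k i" unfolding D_def by auto
      have "x \<in> B k j" for j
      proof (cases "j = i")
        case False
        have "x \<in> D j" using x by blast
        with False show ?thesis by (simp add: D_def)
      qed (use k in simp)
      with B0[of k] show False by blast
    qed
  qed
qed

text \<open>A basic open set of the product restricts only finitely many coordinates, and
  \<open>m\<close> bounds them.\<close>

lemma open_Baire_cylinder: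
  assumes "open (U :: (nat \<Rightarrow> nat) set)" "u \<in> U"
  obtains m where "\<And>v. (\<And>k. k < m \<Longrightarrow> v k = u k) \<Longrightarrow> v \<in> U"
proof -
  obtain X where X: "u \<in> Pi\<^sub>E UNIV X" "finite {i. X i \<noteq> UNIV}" "Pi\<^sub>E UNIV X \<subseteq> U"
    using product_topology_open_contains_basis[of "\<lambda>_. euclidean" UNIV U u] assms
    by (auto simp: open_fun_def)
  obtain m where m: "\<And>i. X i \<noteq> UNIV \<Longrightarrow> i < m"
    using X(2) finite_nat_set_iff_bounded by auto
  have "v \<in> U" if "\<And>k. k < m \<Longrightarrow> v k = u k" for v
  proof -
    have "v i \<in> X i" for i
      using that[of i] m[of i] X(1) by (cases "X i = UNIV") (auto simp: PiE_iff)
    then show ?thesis using X(3) by (auto simp: PiE_iff)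
  qed
  then show ?thesis using that by blast
qed

text \<open>A nonseparable family is cut down to ever smaller cylinders while remaining
  nonseparable. In the limit one code \<open>u i\<close> is left for each \<open>i\<close>. If some
  \<open>u i\<close> were outside \<open>F i\<close>, or two of the points \<open>f i (u i)\<close>
  differed, a late stage would be separable; hence these points form a single common element of all
  \<open>A i\<close>.\<close>

theorem Novikov_separation:
  fixes A :: "nat \<Rightarrow> 'b::t2_space set"
  assumes "\<And>i. analytic_set (A i)" and "(\<Inter>i. A i) = {}"
  shows "borel_separable A"
proof (rule ccontr)
  assume nsep: "\<not> borel_separable A"
  obtain F f where F: "\<And>i. closed (F i :: (nat \<Rightarrow> nat) set)"
    and f: "\<And>i. continuous_on UNIV (f i)" and A: "\<And>i. A i = f i ` F i"
    using assms(1) unfolding analytic_set_def by metis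
  \<comment> \<open>One sequence \<open>z\<close> codes a point of the Baire space for each \<open>i\<close>, so that prolonging \<open>z\<close> by one
    entry splits only one member of the family.\<close>
  define G where "G n z i =
      f i ` {u \<in> F i. \<forall>k. prod_encode (i, k) < n \<longrightarrow> u k = z (prod_encode (i, k))}"
    for n and z :: "nat \<Rightarrow> nat" and i
  have cong: "G n z = G n z'" if "\<And>k. k < n \<Longrightarrow> z k = z' k" for n z z'
    using that unfolding G_def by (intro ext) (auto intro!: arg_cong[where f = "(`) _"])
  \<comment> \<open>The position \<open>n = prod_encode (i, k)\<close> concerns row \<open>i\<close>
    alone, so fixing its entry cuts \<open>G n z i\<close> into countably many pieces and leaves the
    other members unchanged.\<close>
  have step: "\<exists>j. \<not> borel_separable (G (Suc n) (z(n := j)))" if "\<not> borel_separable (G n z)" for n z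
  proof (rule ccontr)
    assume "\<not> ?thesis"
    then have sep: "\<And>j. borel_separable (G (Suc n) (z(n := j)))" by blast
    obtain i k where ik: "n = prod_encode (i, k)" by (metis prod_decode_inverse surj_pair)
    have "borel_separable ((G n z)(i := G (Suc n) (z(n := j)) i))" for j
    proof -
      have "(G n z)(i := G (Suc n) (z(n := j)) i) = G (Suc n) (z(n := j))"
      proof
        fix l show "((G n z)(i := G (Suc n) (z(n := j)) i)) l = G (Suc n) (z(n := j)) l"
        proof (cases "l = i")
          case False
          then have "prod_encode (l, k') \<noteq> n" for k' using ik by simp
          then have "prod_encode (l, k') < Suc n \<longleftrightarrow> prod_encode (l, k') < n" for k'
            by (metis less_Suc_eq)
          with False \<open>\<And>k'. prod_encode (l, k') \<noteq> n\<close> show ?thesis by (simp add: G_def)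
        qed simp
      qed
      with sep show ?thesis by metis
    qed
    moreover have "G n z i \<subseteq> (\<Union>j. G (Suc n) (z(n := j)) i)"
    proof
      fix x assume "x \<in> G n z i"
      then obtain u where u: "u \<in> F i" "x = f i u"
        "\<And>k. prod_encode (i, k) < n \<Longrightarrow> u k = z (prod_encode (i, k))"
        unfolding G_def by auto
      have "x \<in> G (Suc n) (z(n := u k)) i"
        unfolding G_def using u ik by (intro image_eqI[of _ _ u]) (auto simp: less_Suc_eq)
      then show "x \<in> (\<Union>j. G (Suc n) (z(n := j)) i)" by blast
    qed
    ultimately have "borel_separable (G n z)" by (rule borel_separable_split[rotated])
    with that show False ..
  qed
  have "\<not> borel_separable (G 0 undefined)"
    using nsep unfolding G_def A by simp
  then obtain s where s: "\<And>n. \<not> borel_separable (G n (s n))"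
    and s': "\<And>n. \<exists>j. s (Suc n) = (s n)(n := j)"
    using dependent_nat_choice[of "\<lambda>n z. \<not> borel_separable (G n z)" "\<lambda>n z z'. \<exists>j. z' = z(n := j)"]
      step by metis
  \<comment> \<open>Later choices never alter earlier entries, so this diagonal sequence agrees with
    \<open>s n\<close> below \<open>n\<close>.\<close>
  define z where "z n = s (Suc n) n" for n
  have agree: "s n k = z k" if "k < n" for n k
    using that
  proof (induction n)
    case (Suc n)
    show ?case
    proof (cases "k = n")
      case False
      with Suc s'[of n] show ?thesis by auto
    qed (simp add: z_def)
  qed simp
  have nz: "\<not> borel_separable (G n z)" for n
    using s[of n] cong[of n "s n" z] agree by simp
  define u where "u i k = z (prod_encode (i, k))" for i k
  have bound: "\<exists>n. \<forall>k<m. prod_encode (i, k) < n" for i m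
    using finite_nat_set_iff_bounded[of "(\<lambda>k. prod_encode (i, k)) ` {..<m}"] by auto
  \<comment> \<open>At late stages enough entries of row \<open>i\<close> are prescribed to force
    the code into the neighbourhood \<open>W\<close> of \<open>u i\<close>.\<close>
  have local: "\<exists>n. \<forall>n'\<ge>n. G n' z i \<subseteq> f i ` (W \<inter> F i)" if W: "open W" "u i \<in> W" for i W
  proof -
    obtain m where m: "\<And>v. (\<And>k. k < m \<Longrightarrow> v k = u i k) \<Longrightarrow> v \<in> W"
      using open_Baire_cylinder[OF W] by blast
    obtain n where n: "\<forall>k<m. prod_encode (i, k) < n" using bound by blast
    have "G n' z i \<subseteq> f i ` (W \<inter> F i)" if "n' \<ge> n" for n'
    proof -
      have "v \<in> W" if "\<forall>k. prod_encode (i, k) < n' \<longrightarrow> v k = z (prod_encode (i, k))" for v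
        using that n \<open>n' \<ge> n\<close> by (intro m) (auto simp: u_def)
      then show ?thesis unfolding G_def by auto
    qed
    then show ?thesis by blast
  qed
  show False
  proof (cases "\<exists>i. u i \<notin> F i")
    case True
    then obtain i where i: "u i \<in> - F i" by blast
    have "open (- F i)" using F by (rule open_Compl)
    then obtain n where n: "G n z i \<subseteq> f i ` (- F i \<inter> F i)"
      using local[OF _ i] by blast
    \<comment> \<open>Here \<open>G n z i\<close> is empty; \<open>Suc i\<close> merely supplies a
      second index.\<close>
    then have "borel_separable (G n z)"
      by (intro borel_separable_pair[of "{}" UNIV i "Suc i"]) auto
    with nz show False by blast
  next
    case False
    show False
    proof (cases "\<exists>i. f i (u i) \<noteq> f 0 (u 0)")
      case True
      then obtain i where i: "f i (u i) \<noteq> f 0 (u 0)" by blast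
      obtain U V where UV: "open U" "open V" "f i (u i) \<in> U" "f 0 (u 0) \<in> V" "U \<inter> V = {}"
        using hausdorff[OF i] by blast
      have op: "open (f j -` W)" if "open W" for j W
        using that f by (rule open_vimage)
      obtain n1 where n1: "\<And>n'. n' \<ge> n1 \<Longrightarrow> G n' z i \<subseteq> f i ` (f i -` U \<inter> F i)"
        using local[OF op[OF UV(1)] vimageI2[where f = "f i", OF UV(3)]] by blast
      obtain n2 where n2: "\<And>n'. n' \<ge> n2 \<Longrightarrow> G n' z 0 \<subseteq> f 0 ` (f 0 -` V \<inter> F 0)"
        using local[OF op[OF UV(2)] vimageI2[where f = "f 0", OF UV(4)]] by blast
      have "borel_separable (G (max n1 n2) z)"
      proof (rule borel_separable_pair)
        show "i \<noteq> 0" using i by metis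
        show "G (max n1 n2) z i \<subseteq> U" using n1[of "max n1 n2"] by auto
        show "G (max n1 n2) z 0 \<subseteq> V" using n2[of "max n1 n2"] by auto
      qed (use UV in auto)
      with nz show False by blast
    next
      case eq: False
      have "f 0 (u 0) \<in> A i" for i
      proof -
        have "f i (u i) = f 0 (u 0)" "u i \<in> F i" using eq False by blast+
        then show ?thesis unfolding A by (metis imageI)
      qed
      with assms(2) show False by blast
    qed
  qed
qed

text \<open>This is Novikov separation of the family \<open>A, B, B, ...\<close>: as
  \<open>B\<close> lies in every \<open>D i\<close> with \<open>i \<noteq> 0\<close>, it cannot meet
  \<open>D 0\<close>.\<close>

corollary Lusin_separation:
  fixes A B :: "'b::t2_space set"
  assumes "analytic_set A" "analytic_set B" "A \<inter> B = {}"
  obtains D where "D \<in> sets borel" "A \<subseteq> D" "B \<inter> D = {}"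
proof -
  have "(\<Inter>i. if i = (0::nat) then A else B) \<subseteq> A \<inter> B"
  proof
    fix x assume x: "x \<in> (\<Inter>i. if i = (0::nat) then A else B)"
    have "x \<in> A" using INT_D[OF x, of 0] by simp
    moreover have "x \<in> B" using INT_D[OF x, of 1] by simp
    ultimately show "x \<in> A \<inter> B" ..
  qed
  then have "borel_separable (\<lambda>i. if i = 0 then A else B)"
    using assms by (intro Novikov_separation) auto
  then obtain D :: "nat \<Rightarrow> 'b set" where D: "\<And>i. D i \<in> sets borel"
      "\<And>i. (if i = 0 then A else B) \<subseteq> D i" and D0: "(\<Inter>i. D i) = {}"
    unfolding borel_separable_def by blast
  show ?thesis
  proof (rule that)
    show "D 0 \<in> sets borel" "A \<subseteq> D 0" using D(1) D(2)[of 0] by auto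
    have "B \<subseteq> D i" if "i \<noteq> 0" for i using D(2)[of i] that by simp
    show "B \<inter> D 0 = {}"
    proof (rule equals0I)
      fix x assume x: "x \<in> B \<inter> D 0"
      have "x \<in> D i" for i
        using x \<open>\<And>i. i \<noteq> 0 \<Longrightarrow> B \<subseteq> D i\<close> by (cases "i = 0") auto
      with D0 show False by blast
    qed
  qed
qed

section \<open>Borel relations with finite sections\<close>

lemmas analytic_set_borel_Baire_prod =
  analytic_set_borel_prod[OF analytic_set_borel_Baire analytic_set_borel_Baire]

lemma pred_borel_diagonal:
  "Measurable.pred ((borel :: 'b::{second_countable_topology,t2_space} measure) \<Otimes>\<^sub>M borel)
     (\<lambda>p. fst p = snd p)"
proof -
  have "closed {p :: 'b \<times> 'b. fst p = snd p}"
    by (intro closed_Collect_eq continuous_on_fst continuous_on_snd continuous_on_id)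
  then show ?thesis unfolding borel_prod pred_def by (auto intro: borel_closed)
qed

lemma measurable_count_space_borel:
  "f \<in> M \<rightarrow>\<^sub>M count_space UNIV \<Longrightarrow> f \<in> M \<rightarrow>\<^sub>M (borel :: 'b::topological_space measure)"
  by (erule measurable_compose[where g = "\<lambda>j. j"]) simp

text \<open>
  Separating the analytic sets of those \<open>x\<close> whose image has \<open>m\<close>-th coordinate \<open>j\<close>, respectively
  different from \<open>j\<close>, extends the partial function \<open>Q\<close> to a total Borel function \<open>h\<close>; the domain of
  \<open>Q\<close> is then the preimage of \<open>Q\<close> under \<open>x \<mapsto> (x, h x)\<close>.
\<close>

lemma Lusin_Souslin_single_valued:
  fixes Q :: "((nat \<Rightarrow> nat) \<times> (nat \<Rightarrow> nat)) set"
  assumes Q: "Q \<in> sets borel" and sv: "single_valued Q"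
  shows "fst ` Q \<in> sets borel"
proof -
  have an: "analytic_set (fst ` (Q \<inter> {p. snd p m \<in> J}))" for m J
  proof -
    have "open {p :: (nat \<Rightarrow> nat) \<times> (nat \<Rightarrow> nat). snd p m \<in> J}"
      using open_vimage[OF open_vimage_coordinate[OF open_discrete, of m J] continuous_on_snd[OF continuous_on_id]]
      by (simp add: vimage_def)
    then have "Q \<inter> {p. snd p m \<in> J} \<in> sets borel" using Q borel_open sets.Int by blast
    then show ?thesis
      by (intro analytic_set_image analytic_set_borel_Baire_prod continuous_on_fst continuous_on_id)
  qed
  have "\<exists>D. D \<in> sets borel \<and> fst ` (Q \<inter> {p. snd p m \<in> {j}}) \<subseteq> D \<and>
      fst ` (Q \<inter> {p. snd p m \<in> - {j}}) \<inter> D = {}" for m j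
  proof -
    have "fst ` (Q \<inter> {p. snd p m \<in> {j}}) \<inter> fst ` (Q \<inter> {p. snd p m \<in> - {j}}) = {}"
    proof (rule equals0I)
      fix x assume x: "x \<in> fst ` (Q \<inter> {p. snd p m \<in> {j}}) \<inter> fst ` (Q \<inter> {p. snd p m \<in> - {j}})"
      then obtain y z where "(x, y) \<in> Q" "y m = j" "(x, z) \<in> Q" "z m \<noteq> j" by auto
      with single_valuedD[OF sv, of x y z] show False by simp
    qed
    then show ?thesis by (rule Lusin_separation[OF an an]) blast
  qed
  then obtain D where D: "\<And>m j. D m j \<in> sets borel"
    "\<And>m j. fst ` (Q \<inter> {p. snd p m \<in> {j}}) \<subseteq> D m j"
    "\<And>m j. fst ` (Q \<inter> {p. snd p m \<in> - {j}}) \<inter> D m j = {}"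
    by metis
  \<comment> \<open>On the domain of \<open>Q\<close> exactly one \<open>j\<close> qualifies, namely
    the true coordinate. Elsewhere the value is arbitrary, but \<open>LEAST\<close> keeps it
    measurable.\<close>
  define h where "h x m = (LEAST j. x \<in> D m j)" for x m
  have h: "h x = y" if "(x, y) \<in> Q" for x y
  proof
    fix m
    have "x \<in> D m j \<longleftrightarrow> j = y m" for j
      using that D(2)[of m j] D(3)[of m j] by (cases "j = y m") force+
    then show "h x m = y m" unfolding h_def by (metis (mono_tags, lifting) LeastI)
  qed
  have "(\<lambda>x. h x m) \<in> borel \<rightarrow>\<^sub>M borel" for m
  proof -
    have "(\<lambda>x. h x m) \<in> borel \<rightarrow>\<^sub>M count_space UNIV"
      unfolding h_def using D(1) by (intro measurable_Least) auto
    then show ?thesis by (rule measurable_count_space_borel)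
  qed
  then have "h \<in> borel_measurable borel"
    by (rule measurable_coordinatewise_then_product)
  then have "(\<lambda>x. (x, h x)) \<in> borel_measurable borel"
    by (intro borel_measurable_Pair measurable_ident_sets) auto
  from measurable_sets[OF this Q] have "(\<lambda>x. (x, h x)) -` Q \<in> sets borel"
    by simp
  moreover have "fst ` Q = (\<lambda>x. (x, h x)) -` Q"
    using h by force
  ultimately show ?thesis by simp
qed

text \<open>Each point of a finite section is isolated in it by some basic open set. The analytic
  sets \<open>A n\<close> of points not isolated by \<open>U n\<close> thus have empty intersection,
  and Novikov separation yields Borel \<open>B n\<close> above them. The sets \<open>P - B n\<close>
  are single valued and cover \<open>P\<close>; \<open>disjointed\<close> makes them
  disjoint.\<close>

lemma Lusin_Novikov_finite_sections:
  fixes P :: "((nat \<Rightarrow> nat) \<times> (nat \<Rightarrow> nat)) set"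
  assumes P: "P \<in> sets borel" and fin: "\<And>x. finite {y. (x, y) \<in> P}"
  obtains Q where "\<And>n. Q n \<in> sets borel" "\<And>n::nat. single_valued (Q n)"
    "disjoint_family Q" "P = (\<Union>n. Q n)"
proof -
  obtain \<B> :: "(nat \<Rightarrow> nat) set set" where \<B>: "countable \<B>" "topological_basis \<B>"
    using ex_countable_basis by blast
  define U where "U = from_nat_into \<B>"
  have "\<B> \<noteq> {}" using \<B>(2) topological_basisE[of \<B> UNIV undefined] by auto
  then have U: "open (U n)" for n
    using \<B>(2) from_nat_into[of \<B> n] by (auto simp: U_def intro: topological_basis_open)
  have isolate: "\<exists>n. y \<in> U n \<and> U n \<inter> S \<subseteq> {y}" if "finite S" for S y
  proof -
    have "open (- (S - {y}))" using that by (intro open_Compl finite_imp_closed) auto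
    then obtain B where "B \<in> \<B>" "y \<in> B" "B \<subseteq> - (S - {y})"
      using topological_basisE[OF \<B>(2), of "- (S - {y})" y] by blast
    moreover obtain n where "U n = B"
      using from_nat_into_surj[OF \<B>(1) \<open>B \<in> \<B>\<close>] by (auto simp: U_def)
    ultimately show ?thesis by blast
  qed
  define A where "A n = {(x, y). (x, y) \<in> P \<and> (y \<notin> U n \<or> (\<exists>y'. y' \<noteq> y \<and> y' \<in> U n \<and> (x, y') \<in> P))}" for n
  have "analytic_set (A n)" for n
  proof -
    let ?B = "borel :: (nat \<Rightarrow> nat) measure"
    have P': "P \<in> sets (?B \<Otimes>\<^sub>M ?B)" using P by (simp only: borel_prod)
    \<comment> \<open>The existential quantifier over a second point \<open>y'\<close> of the
      section becomes a projection of this Borel set of triples.\<close>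
    define T where "T = {t :: ((nat \<Rightarrow> nat) \<times> (nat \<Rightarrow> nat)) \<times> (nat \<Rightarrow> nat).
      fst t \<in> P \<and> (fst (fst t), snd t) \<in> P \<and> snd t \<in> U n \<and> snd (fst t) \<noteq> snd t}"
    have "T = {t \<in> space ((?B \<Otimes>\<^sub>M ?B) \<Otimes>\<^sub>M ?B). fst t \<in> P \<and> (fst (fst t), snd t) \<in> P \<and>
       snd t \<in> U n \<and> \<not> (\<lambda>p. fst p = snd p) (snd (fst t), snd t)}"
      by (auto simp: T_def space_pair_measure)
    also have "\<dots> \<in> sets ((?B \<Otimes>\<^sub>M ?B) \<Otimes>\<^sub>M ?B)"
    proof -
      have [measurable]: "P \<in> sets (?B \<Otimes>\<^sub>M ?B)" "U n \<in> sets ?B"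
        using P' U by auto
      note pred_borel_diagonal[measurable]
      show ?thesis by measurable
    qed
    finally have "T \<in> sets borel" by (simp only: borel_prod)
    then have "analytic_set T"
      by (intro analytic_set_borel_prod[OF analytic_set_borel_Baire_prod analytic_set_borel_Baire])
    then have "analytic_set (fst ` T)"
      by (intro analytic_set_image continuous_on_fst continuous_on_id)
    moreover have "P \<inter> UNIV \<times> (- U n) \<in> sets borel"
      by (rule sets.Int[OF P borel_closed]) (intro closed_Times closed_UNIV closed_Compl U)
    ultimately have "analytic_set ((P \<inter> UNIV \<times> (- U n)) \<union> fst ` T)"
      using analytic_set_Un analytic_set_borel_Baire_prod by blast
    moreover have "(P \<inter> UNIV \<times> (- U n)) \<union> fst ` T = A n"
      by (force simp: A_def T_def image_iff)
    ultimately show ?thesis by simp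
  qed
  moreover have "(\<Inter>n. A n) = {}"
  proof (rule equals0I)
    fix p assume p: "p \<in> (\<Inter>n. A n)"
    obtain x y where xy: "p = (x, y)" by fastforce
    obtain n where n: "y \<in> U n" "U n \<inter> {y. (x, y) \<in> P} \<subseteq> {y}"
      using isolate[OF fin] by blast
    have "p \<in> A n" using p by blast
    with n show False by (auto simp: A_def xy)
  qed
  ultimately have "borel_separable A" by (rule Novikov_separation)
  then obtain B where B: "\<And>n. B n \<in> sets borel" "\<And>n. A n \<subseteq> B n" "(\<Inter>n. B n) = {}"
    unfolding borel_separable_def by blast
  define Q where "Q = disjointed (\<lambda>n. P - B n)"
  have "single_valued (P - B n)" for n
  proof (rule single_valuedI)
    fix x y z assume xyz: "(x, y) \<in> P - B n" "(x, z) \<in> P - B n"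
    then have "(x, y) \<notin> A n" "(x, z) \<notin> A n" using B(2) by blast+
    with xyz show "y = z" by (auto simp: A_def)
  qed
  then have "single_valued (Q n)" for n
    using disjointed_subset[of "\<lambda>n. P - B n" n] unfolding Q_def by (meson single_valued_subset)
  moreover have "range Q \<subseteq> sets borel"
    unfolding Q_def using P B(1) by (intro sets.range_disjointed_sets) auto
  moreover have "disjoint_family Q" unfolding Q_def by (rule disjoint_family_disjointed)
  moreover have "P = (\<Union>n. Q n)"
    unfolding Q_def UN_disjointed_eq using B(3) by auto
  ultimately show ?thesis by (intro that) auto
qed

section \<open>Standard Borel spaces\<close>

text \<open>A point is coded by the sequence whose \<open>k\<close>-th entry is the first index of a
  dense sequence within distance \<open>1 / (k + 1)\<close>. The codes form a Borel set
  \<open>I\<close>, on which decoding is Borel; outside \<open>I\<close> the decoder is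
  constant.\<close>

lemma (in Metric_space) Baire_code:
  assumes complete: mcomplete and sep: "separable_space mtopology" and ne: "M \<noteq> {}"
    and N: "space N = M" "sets N = sigma_sets M {U. openin mtopology U}"
  shows "\<exists>c r. c \<in> N \<rightarrow>\<^sub>M (borel :: (nat \<Rightarrow> nat) measure) \<and> r \<in> borel \<rightarrow>\<^sub>M N \<and> (\<forall>x\<in>M. r (c x) = x)"
proof -
  obtain C where C: "countable C" "C \<subseteq> M" "mtopology closure_of C = M"
    using sep unfolding separable_space_def by auto
  define q where "q = from_nat_into C"
  have "C \<noteq> {}" using C(3) ne by auto
  then have q: "q n \<in> M" for n using from_nat_into[of C n] C(2) by (auto simp: q_def)
  have dense: "\<exists>n. d x (q n) < e" if "x \<in> M" "e > 0" for x e
  proof -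
    have "\<exists>y\<in>C. y \<in> mball x e" using that C(3) unfolding metric_closure_of by blast
    then show ?thesis
      using from_nat_into_surj[OF C(1)] unfolding q_def mball_def by blast
  qed
  have dN[measurable]: "(\<lambda>x. d x (q n)) \<in> borel_measurable N" for n
  proof -
    have "{x \<in> space N. d x (q n) < e} \<in> sets N" for e
    proof -
      have "{x \<in> space N. d x (q n) < e} = mball (q n) e"
        using q by (auto simp: N mball_def commute)
      then show ?thesis unfolding N by (auto intro: sigma_sets.Basic)
    qed
    then show ?thesis unfolding borel_measurable_iff_less by blast
  qed
  define c where "c x k = (LEAST n. d x (q n) < inverse (Suc k))" for x and k :: nat
  have c1: "d x (q (c x k)) < inverse (Suc k)" if "x \<in> M" for x k
    unfolding c_def by (rule LeastI_ex) (use dense[OF that] in simp)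
  have c2: "inverse (Suc k) \<le> d x (q j)" if "j < c x k" for x j k
    using not_less_Least[of j "\<lambda>n. d x (q n) < inverse (Suc k)"] that by (simp add: c_def)
  have c_meas: "c \<in> N \<rightarrow>\<^sub>M borel"
  proof (rule measurable_coordinatewise_then_product)
    fix k
    have "(\<lambda>x. c x k) \<in> N \<rightarrow>\<^sub>M count_space UNIV"
      unfolding c_def by measurable
    then show "(\<lambda>x. c x k) \<in> N \<rightarrow>\<^sub>M borel" by (rule measurable_count_space_borel)
  qed
  \<comment> \<open>For the code \<open>a\<close> of \<open>x\<close> this limit is the distance
    from \<open>x\<close> to \<open>q n\<close>, so these distances can be read off the code
    measurably.\<close>
  define L where "L n a = lim (\<lambda>k. d (q (a k)) (q n))" for n and a :: "nat \<Rightarrow> nat"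
  have coord[measurable]: "(\<lambda>a :: nat \<Rightarrow> nat. a k) \<in> borel \<rightarrow>\<^sub>M count_space UNIV" for k
  proof -
    have "(\<lambda>a :: nat \<Rightarrow> nat. a k) \<in> borel \<rightarrow>\<^sub>M borel"
      by (intro borel_measurable_continuous_onI continuous_on_product_coordinates)
    then show ?thesis
      by (simp add: measurable_cong_sets[OF refl sets_borel_eq_count_space])
  qed
  have L_meas[measurable]: "L n \<in> borel_measurable borel" for n
    unfolding L_def
    by (intro borel_measurable_lim_metric measurable_compose[OF coord, of "\<lambda>i. d (q i) (q n)"]) auto
  \<comment> \<open>The first condition makes \<open>q (a k)\<close> Cauchy; the second is the
    \<open>LEAST\<close> in \<open>c\<close>, with distances expressed by \<open>L\<close>.
    Quantifying over \<open>n\<close> with \<open>a k = n\<close> leaves only functions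
    \<open>L n\<close> of fixed index, whose measurability is known.\<close>
  define I where "I = {a. (\<forall>k l. d (q (a k)) (q (a l)) \<le> inverse (Suc k) + inverse (Suc l)) \<and>
    (\<forall>k n. a k = n \<longrightarrow> L n a < inverse (Suc k) \<and> (\<forall>j<n. inverse (Suc k) \<le> L j a))}"
  have I_meas[measurable]: "I \<in> sets borel"
  proof -
    have [measurable]: "Measurable.pred borel (\<lambda>a :: nat \<Rightarrow> nat. d (q (a k)) (q (a l)) \<le> inverse (Suc k) + inverse (Suc l))" for k l
      by (rule measurable_compose_countable[OF _ coord, of "\<lambda>i a. d (q i) (q (a l)) \<le> _"],
          rule measurable_compose[OF coord]) simp
    have [measurable]: "Measurable.pred borel (\<lambda>a :: nat \<Rightarrow> nat. a k = n)" for k n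
      using coord by measurable
    have "I = {a \<in> space borel. (\<forall>k l. d (q (a k)) (q (a l)) \<le> inverse (Suc k) + inverse (Suc l)) \<and>
    (\<forall>k n. a k = n \<longrightarrow> L n a < inverse (Suc k) \<and> (\<forall>j<n. inverse (Suc k) \<le> L j a))}"
      by (simp add: I_def)
    also have "\<dots> \<in> sets borel" by measurable
    finally show ?thesis .
  qed
  have lim_L: "L n a = d x (q n)"
    if "x \<in> M" "(\<lambda>k. d (q (a k)) x) \<longlonglongrightarrow> 0" for x a n
  proof -
    have "\<bar>d (q (a k)) (q n) - d x (q n)\<bar> \<le> d (q (a k)) x" for k
      using mdist_reverse_triangle[of "q (a k)" x "q n"] q that(1)
      by (smt (verit) commute triangle)
    then have "(\<lambda>k. d (q (a k)) (q n) - d x (q n)) \<longlonglongrightarrow> 0"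
      by (intro Lim_null_comparison[OF _ that(2)] always_eventually) simp
    then have "(\<lambda>k. d (q (a k)) (q n)) \<longlonglongrightarrow> d x (q n)" by (simp add: LIM_zero_iff)
    then show ?thesis unfolding L_def by (rule limI)
  qed
  have L_c: "L n (c x) = d x (q n)" if "x \<in> M" for x n
  proof (rule lim_L[OF that])
    show "(\<lambda>k. d (q (c x k)) x) \<longlonglongrightarrow> 0"
    proof (rule Lim_null_comparison[OF _ LIMSEQ_inverse_real_of_nat])
      show "\<forall>\<^sub>F k in sequentially. norm (d (q (c x k)) x) \<le> inverse (Suc k)"
        using c1[OF that] by (intro always_eventually allI) (simp add: commute less_imp_le)
    qed
  qed
  have c_I: "c x \<in> I" if x: "x \<in> M" for x
  proof -
    have "d (q (c x k)) (q (c x l)) \<le> inverse (Suc k) + inverse (Suc l)" for k l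
      using triangle[of "q (c x k)" x "q (c x l)"] q x c1[OF x, of k] c1[OF x, of l]
      by (simp add: commute)
    moreover have "L (c x k) (c x) < inverse (Suc k)" for k
      using c1[OF x, of k] L_c[OF x] by simp
    moreover have "inverse (Suc k) \<le> L j (c x)" if "j < c x k" for j k
      using c2[OF that] L_c[OF x] by simp
    ultimately show ?thesis unfolding I_def by blast
  qed
  \<comment> \<open>Completeness supplies a limit \<open>x\<close>; its distances to the dense
    points are the values \<open>L n a\<close>, so the second condition in \<open>I\<close>
    identifies \<open>a\<close> with \<open>c x\<close>.\<close>
  have I_c: "\<exists>x\<in>M. c x = a" if a: "a \<in> I" for a
  proof -
    have a1: "d (q (a k)) (q (a l)) \<le> inverse (Suc k) + inverse (Suc l)" for k l
      using a unfolding I_def by blast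
    have a2: "L (a k) a < inverse (Suc k)" for k using a unfolding I_def by blast
    have a3: "inverse (Suc k) \<le> L j a" if "j < a k" for j k using a that unfolding I_def by blast
    have "MCauchy (\<lambda>k. q (a k))"
      unfolding MCauchy_def
    proof (intro conjI allI impI)
      show "range (\<lambda>k. q (a k)) \<subseteq> M" using q by auto
      fix e :: real assume "e > 0"
      then obtain N where N: "inverse (Suc N) < e / 2" using reals_Archimedean[of "e / 2"] by auto
      have "d (q (a k)) (q (a l)) < e" if "N \<le> k" "N \<le> l" for k l
      proof -
        have "inverse (Suc k) \<le> inverse (real (Suc N))" "inverse (Suc l) \<le> inverse (real (Suc N))"
          using that by (auto intro!: le_imp_inverse_le)
        with a1[of k l] N show ?thesis by linarith
      qed
      then show "\<exists>N. \<forall>k l. N \<le> k \<longrightarrow> N \<le> l \<longrightarrow> d (q (a k)) (q (a l)) < e" by blast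
    qed
    then obtain x where x: "limitin mtopology (\<lambda>k. q (a k)) x sequentially"
      using complete unfolding mcomplete_def by blast
    then have xM: "x \<in> M" and lim: "(\<lambda>k. d (q (a k)) x) \<longlonglongrightarrow> 0"
      by (auto simp: limitin_metric_dist_null)
    have "c x k = a k" for k
      unfolding c_def using a2[of k] a3[of _ k] lim_L[OF xM lim]
      by (intro Least_equality) (auto simp: not_less[symmetric])
    then show ?thesis using xM by (intro bexI[of _ x]) auto
  qed
  have c_inj: "x = y" if "x \<in> M" "y \<in> M" "c x = c y" for x y
  proof -
    have eq: "d x (q n) = d y (q n)" for n using L_c[of x n] L_c[of y n] that by simp
    have "d x y \<le> e" if e: "e > 0" for e
    proof -
      obtain n where "d x (q n) < e / 2" using dense[of x "e / 2"] \<open>x \<in> M\<close> e by auto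
      moreover have "d y (q n) < e / 2" using calculation eq by simp
      moreover have "d x y \<le> d x (q n) + d y (q n)"
        using triangle[of x "q n" y] q \<open>x \<in> M\<close> \<open>y \<in> M\<close> by (simp add: commute)
      ultimately show ?thesis by linarith
    qed
    then have "d x y \<le> 0" by (metis field_le_epsilon add_0)
    then show ?thesis using \<open>x \<in> M\<close> \<open>y \<in> M\<close> by (metis nonneg order_antisym zero)
  qed
  obtain x0 where x0: "x0 \<in> M" using ne by blast
  define r where "r a = (if a \<in> I then inv_into M c a else x0)" for a
  have rc: "r (c x) = x" if "x \<in> M" for x
    using c_I[OF that] c_inj that by (auto simp: r_def inj_on_def intro!: inv_into_f_f)
  have r_M: "r a \<in> M" for a
    using I_c[of a] x0 by (auto simp: r_def intro!: inv_into_into)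
  have L_r: "L n a = d (r a) (q n)" if "a \<in> I" for a n
    using I_c[OF that] L_c rc by metis
  have "r \<in> borel \<rightarrow>\<^sub>M N"
  proof (rule measurable_sigma_sets[OF N(2)])
    show "r \<in> space borel \<rightarrow> M" using r_M by auto
    show "{U. openin mtopology U} \<subseteq> Pow M"
      by (auto simp: openin_mtopology)
    fix U assume "U \<in> {U. openin mtopology U}"
    then have U: "U \<subseteq> M" "\<And>x. x \<in> U \<Longrightarrow> \<exists>e>0. mball x e \<subseteq> U" by (auto simp: openin_mtopology)
    \<comment> \<open>\<open>K\<close> indexes countably many balls with dense centres inside
      \<open>U\<close>; they exhaust \<open>U\<close>, and \<open>L\<close> detects which of them
      contain \<open>r a\<close>.\<close>
    define K where "K = {(n, k :: nat). mball (q n) (inverse (Suc k)) \<subseteq> U}"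
    have U_eq: "r a \<in> U \<longleftrightarrow> (\<exists>p\<in>K. L (fst p) a < inverse (Suc (snd p)))" if a: "a \<in> I" for a
    proof
      assume "r a \<in> U"
      then obtain e where e: "e > 0" "mball (r a) e \<subseteq> U" using U by blast
      obtain k where k: "inverse (Suc k) < e / 2" using reals_Archimedean[of "e / 2"] e by auto
      obtain n where n: "d (r a) (q n) < inverse (Suc k)" using dense[OF r_M, of "inverse (Suc k)"] by auto
      have "mball (q n) (inverse (Suc k)) \<subseteq> mball (r a) e"
      proof
        fix y assume "y \<in> mball (q n) (inverse (Suc k))"
        then show "y \<in> mball (r a) e"
          using triangle[of "r a" "q n" y] k n r_M q by (auto simp: mball_def)
      qed
      with e n L_r[OF a] show "\<exists>p\<in>K. L (fst p) a < inverse (Suc (snd p))"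
        by (intro bexI[of _ "(n, k)"]) (auto simp: K_def)
    next
      assume "\<exists>p\<in>K. L (fst p) a < inverse (Suc (snd p))"
      then obtain n k where "mball (q n) (inverse (Suc k)) \<subseteq> U" "L n a < inverse (Suc k)"
        by (auto simp: K_def)
      then show "r a \<in> U" using L_r[OF a] r_M q by (auto simp: mball_def commute)
    qed
    have "r -` U \<inter> space borel =
      (I \<inter> (\<Union>p\<in>K. {a \<in> space borel. L (fst p) a < inverse (Suc (snd p))})) \<union> (if x0 \<in> U then - I else {})"
      (is "_ = ?R")
    proof (rule Set.set_eqI)
      fix a show "a \<in> r -` U \<inter> space borel \<longleftrightarrow> a \<in> ?R"
        using U_eq[of a] by (cases "a \<in> I") (auto simp: r_def)
    qed
    also have "\<dots> \<in> sets borel"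
      by (intro sets.Un sets.Int I_meas sets.countable_UN') auto
    finally show "r -` U \<inter> space borel \<in> sets borel" .
  qed
  with c_meas rc show ?thesis by blast
qed

lemma standard_borel_space_Baire_code:
  assumes "standard_borel_space N" "space N \<noteq> {}"
  obtains c r where "c \<in> N \<rightarrow>\<^sub>M (borel :: (nat \<Rightarrow> nat) measure)" "r \<in> borel \<rightarrow>\<^sub>M N"
    "\<And>x. x \<in> space N \<Longrightarrow> r (c x) = x"
proof -
  obtain T where T: "topspace T = space N" "completely_metrizable_space T" "separable_space T"
    "sets N = sigma_sets (space N) {U. openin T U}"
    using assms(1) unfolding standard_borel_space_def by blast
  obtain M d where M: "Metric_space M d" "Metric_space.mcomplete M d" "T = Metric_space.mtopology M d"
    using T(2) unfolding completely_metrizable_space_def by blast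
  interpret Metric_space M d by (rule M(1))
  have "space N = M" using T(1) M(3) by simp
  then show ?thesis
    using Baire_code[of N] T M assms(2) that by metis
qed

text \<open>The adjacency relation is transported to codes and split into disjoint single-valued
  Borel pieces \<open>Q n\<close>, whose domains \<open>D n\<close> are Borel. The number of
  neighbours of \<open>x\<close> in \<open>A\<close> is then the number of \<open>n\<close> with
  \<open>c x \<in> D n\<close>.\<close>

lemma sets_card_neighbours:
  assumes X: "standard_borel_space X" and E: "E \<in> sets (X \<Otimes>\<^sub>M X)"
    and fin: "\<And>x. x \<in> space X \<Longrightarrow> finite (neighbours E x)" and A: "A \<in> sets X"
  shows "{x \<in> space X. card (neighbours E x \<inter> A) = k} \<in> sets X"
proof (cases "space X = {}")
  case False
  obtain c :: "'a \<Rightarrow> nat \<Rightarrow> nat" and r where c[measurable]: "c \<in> X \<rightarrow>\<^sub>M (borel :: (nat \<Rightarrow> nat) measure)"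
    and r[measurable]: "r \<in> borel \<rightarrow>\<^sub>M X" and rc: "\<And>x. x \<in> space X \<Longrightarrow> r (c x) = x"
    using standard_borel_space_Baire_code[OF X False] by metis
  let ?B = "borel :: (nat \<Rightarrow> nat) measure"
  note E[measurable] A[measurable]
  \<comment> \<open>The condition \<open>c (r b) = b\<close> keeps one code per vertex, so that
    sections are counted correctly and are finite.\<close>
  define P where "P = {(a, b). c (r b) = b \<and> (r a, r b) \<in> E \<and> r b \<in> A}"
  have "P = {p \<in> space (?B \<Otimes>\<^sub>M ?B). (\<lambda>p. fst p = snd p) (c (r (snd p)), snd p) \<and>
      (r (fst p), r (snd p)) \<in> E \<and> r (snd p) \<in> A}"
    by (auto simp: P_def space_pair_measure)
  also have "\<dots> \<in> sets (?B \<Otimes>\<^sub>M ?B)"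
  proof -
    note pred_borel_diagonal[measurable]
    show ?thesis by measurable
  qed
  finally have P: "P \<in> sets borel" by (simp only: borel_prod)
  have r_space: "r a \<in> space X" for a using measurable_space[OF r] by simp
  have "finite {b. (a, b) \<in> P}" for a
  proof (rule finite_subset)
    show "{b. (a, b) \<in> P} \<subseteq> c ` neighbours E (r a)"
      by (force simp: P_def neighbours_def image_iff)
  qed (use fin r_space in blast)
  from Lusin_Novikov_finite_sections[OF P this] obtain Q where Q: "\<And>n. Q n \<in> sets borel"
    "\<And>n::nat. single_valued (Q n)" "disjoint_family Q" "P = (\<Union>n. Q n)" by blast
  define D where "D n = fst ` Q n" for n
  have D[measurable]: "D n \<in> sets borel" for n
    unfolding D_def using Q by (intro Lusin_Souslin_single_valued)
  have E_space: "E \<subseteq> space X \<times> space X"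
    using sets.sets_into_space[OF E] by (simp add: space_pair_measure)
  have bij: "\<exists>g. bij_betw g {n. c x \<in> D n} (neighbours E x \<inter> A)" if x: "x \<in> space X" for x
  proof -
    have "\<exists>b. (c x, b) \<in> Q n" if "c x \<in> D n" for n using that by (auto simp: D_def)
    then obtain b where b: "\<And>n. c x \<in> D n \<Longrightarrow> (c x, b n) \<in> Q n" by metis
    have P_b: "(c x, b n) \<in> P" if "c x \<in> D n" for n using b[OF that] Q(4) by blast
    have "bij_betw (\<lambda>n. r (b n)) {n. c x \<in> D n} (neighbours E x \<inter> A)"
      unfolding bij_betw_def
    proof (intro conjI equalityI subsetI inj_onI)
      fix n m assume nm: "n \<in> {n. c x \<in> D n}" "m \<in> {n. c x \<in> D n}" "r (b n) = r (b m)"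
      then have "b n = b m" using P_b[of n] P_b[of m] by (auto simp: P_def)
      then have "(c x, b n) \<in> Q n \<inter> Q m" using b[of n] b[of m] nm(1,2) by auto
      then show "n = m" using Q(3) by (auto simp: disjoint_family_on_def)
    next
      fix y assume "y \<in> (\<lambda>n. r (b n)) ` {n. c x \<in> D n}"
      then show "y \<in> neighbours E x \<inter> A"
        using P_b rc[OF x] by (auto simp: P_def neighbours_def)
    next
      fix y assume y: "y \<in> neighbours E x \<inter> A"
      then have ry: "r (c y) = y" using E_space rc by (auto simp: neighbours_def)
      then have "(c x, c y) \<in> P" using y rc[OF x] by (auto simp: P_def neighbours_def)
      then obtain n where n: "(c x, c y) \<in> Q n" using Q(4) by blast
      then have "c x \<in> D n" by (force simp: D_def)
      moreover have "b n = c y" using b[OF calculation] n Q(2) by (meson single_valuedD)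
      ultimately show "y \<in> (\<lambda>n. r (b n)) ` {n. c x \<in> D n}" using ry by (auto simp: image_iff)
    qed
    then show ?thesis by blast
  qed
  \<comment> \<open>There are only countably many finite sets \<open>J\<close>; \<open>Y J\<close>
    consists of the points for which \<open>J\<close> is exactly the set of \<open>n\<close> with
    \<open>c x \<in> D n\<close>.\<close>
  define \<J> where "\<J> = {J :: nat set. finite J \<and> card J = k}"
  define Y where "Y J = {x \<in> space X. \<forall>n. n \<in> J \<longleftrightarrow> c x \<in> D n}" for J
  have "{x \<in> space X. card (neighbours E x \<inter> A) = k} = (\<Union>J\<in>\<J>. Y J)"
  proof (intro equalityI subsetI)
    fix x assume x: "x \<in> {x \<in> space X. card (neighbours E x \<inter> A) = k}"
    then obtain g where g: "bij_betw g {n. c x \<in> D n} (neighbours E x \<inter> A)" using bij by blast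
    have "finite (neighbours E x \<inter> A)" using x fin by blast
    then have "{n. c x \<in> D n} \<in> \<J>"
      using x bij_betw_same_card[OF g] bij_betw_finite[OF g] by (simp add: \<J>_def)
    moreover have "x \<in> Y {n. c x \<in> D n}" using x by (simp add: Y_def)
    ultimately show "x \<in> (\<Union>J\<in>\<J>. Y J)" by blast
  next
    fix x assume "x \<in> (\<Union>J\<in>\<J>. Y J)"
    then obtain J where J: "J \<in> \<J>" "x \<in> Y J" by blast
    have "J = {n. c x \<in> D n}" using J(2) by (auto simp: Y_def)
    moreover have "card J = k" using J(1) by (simp add: \<J>_def)
    moreover have "x \<in> space X" using J(2) by (simp add: Y_def)
    moreover obtain g where g: "bij_betw g {n. c x \<in> D n} (neighbours E x \<inter> A)"
      using bij[OF calculation(3)] by blast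
    ultimately show "x \<in> {x \<in> space X. card (neighbours E x \<inter> A) = k}"
      using bij_betw_same_card[OF g] by simp
  qed
  also have "\<dots> \<in> sets X"
  proof (rule sets.countable_UN'')
    show "countable \<J>"
      unfolding \<J>_def using countable_Collect_finite by (rule countable_subset[rotated]) auto
    show "Y J \<in> sets X" for J unfolding Y_def by measurable
  qed
  finally show ?thesis .
qed simp

section \<open>Equitable colourings of amenable graphs\<close>

text \<open>Bolzano-Weierstrass is applied to one sequence at a time, passing to a further
  subsequence at each step.\<close>

lemma finite_family_convergent_subseq:
  fixes a :: "'k \<Rightarrow> nat \<Rightarrow> real"
  assumes "finite K" "\<And>k. k \<in> K \<Longrightarrow> bounded (range (a k))"
  shows "\<exists>\<sigma> :: nat \<Rightarrow> nat. strict_mono \<sigma> \<and> (\<forall>k\<in>K. convergent (a k \<circ> \<sigma>))"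
  using assms
proof (induction K)
  case empty
  show ?case by (intro exI[of _ id]) (auto simp: strict_mono_def)
next
  case (insert k K)
  have "\<exists>\<sigma> :: nat \<Rightarrow> nat. strict_mono \<sigma> \<and> (\<forall>k\<in>K. convergent (a k \<circ> \<sigma>))"
    by (rule insert.IH) (simp add: insert.prems)
  then obtain \<sigma> :: "nat \<Rightarrow> nat" where \<sigma>: "strict_mono \<sigma>" "\<And>j. j \<in> K \<Longrightarrow> convergent (a j \<circ> \<sigma>)" by blast
  have "bounded (range (a k \<circ> \<sigma>))"
    using insert.prems by (rule bounded_subset) auto
  then obtain l \<tau> where \<tau>: "strict_mono \<tau>" "((a k \<circ> \<sigma>) \<circ> \<tau>) \<longlonglongrightarrow> l"
    using bounded_imp_convergent_subsequence by blast
  have "convergent (a j \<circ> (\<sigma> \<circ> \<tau>))" if "j \<in> insert k K" for j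
    using that \<tau> \<sigma>(2)[of j] convergent_subseq_convergent[of "a j \<circ> \<sigma>" \<tau>]
    by (auto simp: comp_assoc convergent_def)
  moreover have "strict_mono (\<sigma> \<circ> \<tau>)" using \<sigma>(1) \<tau>(1) by (rule strict_mono_o)
  ultimately show ?case by blast
qed

text \<open>Edges inside \<open>S\<close> contribute equally to \<open>W i j\<close> and
  \<open>W j i\<close>. What remains crosses into the outer boundary, where each vertex receives at
  most \<open>K\<close>. The lemma serves both for the matching, with \<open>K = 1\<close>, and for
  counting edges, with \<open>K\<close> a degree bound.\<close>

lemma symmetric_flow_imbalance:
  fixes F :: "'a \<Rightarrow> 'a \<Rightarrow> real" and \<kappa> :: "'a \<Rightarrow> 'c"
  assumes E: "sym E" and S: "finite S" "S \<subseteq> C"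
    and closed: "\<And>x. x \<in> C \<Longrightarrow> neighbours E x \<subseteq> C"
    and fin: "\<And>x. x \<in> C \<Longrightarrow> finite (neighbours E x)"
    and F: "\<And>x y. x \<in> C \<Longrightarrow> (x, y) \<in> E \<Longrightarrow> 0 \<le> F x y \<and> F x y = F y x"
    and K: "\<And>x. x \<in> C \<Longrightarrow> (\<Sum>y\<in>neighbours E x. F x y) \<le> K"
  defines "W \<equiv> \<lambda>i j. \<Sum>x\<in>{x \<in> S. \<kappa> x = i}. \<Sum>y\<in>{y \<in> neighbours E x. \<kappa> y = j}. F x y"
  shows "\<bar>W i j - W j i\<bar> \<le> K * card (outer_vertex_boundary C (E \<inter> C \<times> C) S)"
proof -
  let ?B = "outer_vertex_boundary C (E \<inter> C \<times> C) S"
  define Z where "Z i j = (\<Sum>x\<in>{x \<in> S. \<kappa> x = i}. \<Sum>y\<in>{y \<in> S. (x, y) \<in> E \<and> \<kappa> y = j}. F x y)" for i j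
  define R where "R i j = (\<Sum>x\<in>{x \<in> S. \<kappa> x = i}. \<Sum>y\<in>{y \<in> ?B. (x, y) \<in> E \<and> \<kappa> y = j}. F x y)" for i j
  have B: "?B \<subseteq> (\<Union>x\<in>S. neighbours E x)" by (auto simp: outer_vertex_boundary_def neighbours_def)
  have finB: "finite ?B"
    using S fin by (intro finite_subset[OF B]) auto
  have BC: "?B \<subseteq> C" by (auto simp: outer_vertex_boundary_def)
  have W: "W i j = Z i j + R i j" for i j
  proof -
    have "(\<Sum>y\<in>{y \<in> neighbours E x. \<kappa> y = j}. F x y) =
      (\<Sum>y\<in>{y \<in> S. (x, y) \<in> E \<and> \<kappa> y = j}. F x y) + (\<Sum>y\<in>{y \<in> ?B. (x, y) \<in> E \<and> \<kappa> y = j}. F x y)"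
      if x: "x \<in> S" for x
    proof -
      have "{y \<in> neighbours E x. \<kappa> y = j} =
        {y \<in> S. (x, y) \<in> E \<and> \<kappa> y = j} \<union> {y \<in> ?B. (x, y) \<in> E \<and> \<kappa> y = j}"
        using x closed[of x] S(2) by (auto simp: neighbours_def outer_vertex_boundary_def)
      moreover have "{y \<in> S. (x, y) \<in> E \<and> \<kappa> y = j} \<inter> {y \<in> ?B. (x, y) \<in> E \<and> \<kappa> y = j} = {}"
        by (auto simp: outer_vertex_boundary_def)
      ultimately show ?thesis using S(1) finB by (simp add: sum.union_disjoint)
    qed
    then show ?thesis unfolding W_def Z_def R_def sum.distrib[symmetric] by (intro sum.cong) auto
  qed
  have Z_swap: "Z i j = Z j i" for i j
  proof -
    have "Z i j = (\<Sum>x\<in>{x \<in> S. \<kappa> x = i}. \<Sum>y\<in>{y \<in> {y \<in> S. \<kappa> y = j}. (x, y) \<in> E}. F x y)"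
      unfolding Z_def by (intro sum.cong refl) auto
    also have "\<dots> = (\<Sum>y\<in>{y \<in> S. \<kappa> y = j}. \<Sum>x\<in>{x \<in> {x \<in> S. \<kappa> x = i}. (x, y) \<in> E}. F x y)"
      using S(1) by (intro sum.swap_restrict) auto
    also have "\<dots> = Z j i"
      unfolding Z_def using F S(2) symD[OF E] by (intro sum.cong refl) (auto)
    finally show ?thesis .
  qed
  have R: "0 \<le> R i j \<and> R i j \<le> K * card ?B" for i j
  proof
    show "0 \<le> R i j" unfolding R_def using F S(2) by (intro sum_nonneg) auto
    have "R i j \<le> (\<Sum>x\<in>S. \<Sum>y\<in>{y \<in> ?B. (x, y) \<in> E}. F x y)"
    proof -
      have "R i j \<le> (\<Sum>x\<in>{x \<in> S. \<kappa> x = i}. \<Sum>y\<in>{y \<in> ?B. (x, y) \<in> E}. F x y)"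
        unfolding R_def using F S(2) finB by (intro sum_mono sum_mono2) auto
      also have "\<dots> \<le> (\<Sum>x\<in>S. \<Sum>y\<in>{y \<in> ?B. (x, y) \<in> E}. F x y)"
        using F S by (intro sum_mono2 sum_nonneg) auto
      finally show ?thesis .
    qed
    \<comment> \<open>Summing from the boundary side makes the bound \<open>K\<close> available at
      each boundary vertex.\<close>
    also have "\<dots> = (\<Sum>y\<in>?B. \<Sum>x\<in>{x \<in> S. (x, y) \<in> E}. F x y)"
      using S(1) finB by (intro sum.swap_restrict)
    also have "\<dots> \<le> (\<Sum>y\<in>?B. K)"
    proof (rule sum_mono)
      fix y assume y: "y \<in> ?B"
      have "(\<Sum>x\<in>{x \<in> S. (x, y) \<in> E}. F x y) = (\<Sum>x\<in>{x \<in> S. (x, y) \<in> E}. F y x)"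
        using F S(2) by (intro sum.cong) auto
      also have "\<dots> \<le> (\<Sum>x\<in>neighbours E y. F y x)"
        using y BC fin F symD[OF E] by (intro sum_mono2) (auto simp: neighbours_def)
      also have "\<dots> \<le> K" using y BC K by auto
      finally show "(\<Sum>x\<in>{x \<in> S. (x, y) \<in> E}. F x y) \<le> K" .
    qed
    finally show "R i j \<le> K * card ?B" by (simp add: mult.commute)
  qed
  show ?thesis
    using R[of i j] R[of j i] Z_swap[of i j] unfolding W by (simp add: abs_le_iff)
qed

text \<open>The value \<open>g i j\<close> is the limiting average of \<open>f\<close> over edges
  from colour \<open>i\<close> to colour \<open>j\<close>. Total weight and edge count per vertex of
  the Folner set tend to \<open>\<omega> i j\<close> and \<open>d i j * P i\<close>. Both limits are
  symmetric because the boundary is negligible, hence so is their quotient.\<close>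

proposition amenable_equitable_fractional_matching:
  fixes E :: "('a \<times> 'a) set" and \<kappa> :: "'a \<Rightarrow> nat" and f :: "'a \<times> 'a \<Rightarrow> real" and d :: "nat \<Rightarrow> nat \<Rightarrow> nat"
  assumes E: "sym E" and ne: "C \<noteq> {}"
    and closed: "\<And>x. x \<in> C \<Longrightarrow> neighbours E x \<subseteq> C"
    and conn: "\<And>x y. x \<in> C \<Longrightarrow> y \<in> C \<Longrightarrow> (x, y) \<in> E\<^sup>*"
    and fin: "\<And>x. x \<in> C \<Longrightarrow> finite (neighbours E x)"
    and f: "\<And>x y. x \<in> C \<Longrightarrow> (x, y) \<in> E \<Longrightarrow> 0 \<le> f (x, y) \<and> f (x, y) \<le> 1 \<and> f (x, y) = f (y, x)"
    and f1: "\<And>x. x \<in> C \<Longrightarrow> (\<Sum>y\<in>neighbours E x. f (x, y)) = 1"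
    and Folner: "\<And>e::real. e > 0 \<Longrightarrow> \<exists>S. S \<subseteq> C \<and> finite S \<and> S \<noteq> {} \<and>
      card (outer_vertex_boundary C (E \<inter> C \<times> C) S) < e * card S"
    and colors: "finite (\<kappa> ` C)"
    and d: "\<And>x j. x \<in> C \<Longrightarrow> card {y \<in> neighbours E x. \<kappa> y = j} = d (\<kappa> x) j"
  shows "\<exists>g :: nat \<Rightarrow> nat \<Rightarrow> real. (\<forall>i j. 0 \<le> g i j \<and> g i j \<le> 1 \<and> g i j = g j i) \<and>
    (\<forall>x\<in>C. (\<Sum>y\<in>neighbours E x. g (\<kappa> x) (\<kappa> y)) = 1)"
proof -
  let ?I = "\<kappa> ` C"
  have "\<exists>S. \<forall>n::nat. S n \<subseteq> C \<and> finite (S n) \<and> S n \<noteq> {} \<and>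
      card (outer_vertex_boundary C (E \<inter> C \<times> C) (S n)) < inverse (Suc n) * card (S n)"
    by (intro choice allI Folner) auto
  then obtain S where S: "\<And>n::nat. S n \<subseteq> C" "\<And>n. finite (S n)" "\<And>n. S n \<noteq> {}"
      "\<And>n. card (outer_vertex_boundary C (E \<inter> C \<times> C) (S n)) < inverse (Suc n) * card (S n)"
    by blast
  define N where "N n = real (card (S n))" for n
  have N: "N n > 0" for n unfolding N_def using S(2,3)[of n] by (simp add: card_gt_0_iff)
  define s where "s n i = {x \<in> S n. \<kappa> x = i}" for n i
  have sC: "x \<in> C" if "x \<in> s n i" for x n i using that S(1)[of n] by (auto simp: s_def)
  define W where "W n i j = (\<Sum>x\<in>s n i. \<Sum>y\<in>{y \<in> neighbours E x. \<kappa> y = j}. f (x, y))" for n i j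
  define w where "w = (\<lambda>(i, j) n. W n i j / N n)"
  define p where "p i n = card (s n i) / N n" for i n
  \<comment> \<open>A crude uniform degree bound, used as \<open>K\<close> when counting
    edges.\<close>
  define D where "D = real (\<Sum>i\<in>?I. \<Sum>j\<in>?I. d i j)"
  have by_color: "(\<Sum>y\<in>neighbours E x. h y) = (\<Sum>j\<in>?I. \<Sum>y\<in>{y \<in> neighbours E x. \<kappa> y = j}. h y)"
    if "x \<in> C" for x and h :: "'a \<Rightarrow> real"
    using that fin closed[OF that] colors by (intro sum.group[symmetric]) auto
  have deg: "real (card (neighbours E x)) \<le> D" if x: "x \<in> C" for x
  proof -
    have "real (card (neighbours E x)) = (\<Sum>y\<in>neighbours E x. 1)" by simp
    also have "\<dots> = (\<Sum>j\<in>?I. real (d (\<kappa> x) j))" unfolding by_color[OF x] using d[OF x] by simp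
    also have "\<dots> \<le> (\<Sum>i\<in>?I. \<Sum>j\<in>?I. real (d i j))"
      using x colors member_le_sum[of "\<kappa> x" ?I "\<lambda>i. \<Sum>j\<in>?I. real (d i j)"] by (simp add: sum_nonneg)
    finally show ?thesis by (simp add: D_def)
  qed
  have W_nonneg: "0 \<le> W n i j" for n i j
    unfolding W_def using f sC by (intro sum_nonneg) (auto simp: neighbours_def)
  have W_le: "W n i j \<le> d i j * card (s n i)" for n i j
  proof -
    have "W n i j \<le> (\<Sum>x\<in>s n i. \<Sum>y\<in>{y \<in> neighbours E x. \<kappa> y = j}. 1)"
      unfolding W_def using f sC by (intro sum_mono) (auto simp: neighbours_def)
    also have "\<dots> = (\<Sum>x\<in>s n i. real (d i j))"
      using d sC by (intro sum.cong) (auto simp: s_def)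
    finally show ?thesis by (simp add: mult.commute)
  qed
  have W_sum: "(\<Sum>j\<in>?I. W n i j) = card (s n i)" for n i
  proof -
    have "(\<Sum>j\<in>?I. W n i j) = (\<Sum>x\<in>s n i. \<Sum>j\<in>?I. \<Sum>y\<in>{y \<in> neighbours E x. \<kappa> y = j}. f (x, y))"
      unfolding W_def by (rule sum.swap)
    also have "\<dots> = (\<Sum>x\<in>s n i. 1)"
      using f1 sC by (intro sum.cong) (auto simp: by_color[symmetric])
    finally show ?thesis by simp
  qed
  have p_sum: "(\<Sum>i\<in>?I. p i n) = 1" for n
  proof -
    have "card (S n) = (\<Sum>i\<in>?I. card (s n i))"
      unfolding s_def card_eq_sum using S(1,2)[of n] colors by (intro sum.group[symmetric]) auto
    then have "(\<Sum>i\<in>?I. real (card (s n i))) = N n" unfolding N_def by simp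
    then show ?thesis unfolding p_def using N[of n] by (simp add: sum_divide_distrib[symmetric])
  qed
  have small: "card (outer_vertex_boundary C (E \<inter> C \<times> C) (S n)) / N n \<le> inverse (Suc n)" for n
    using S(4)[of n] N[of n] by (simp add: N_def divide_le_eq)
  have w_swap: "\<bar>w (i, j) n - w (j, i) n\<bar> \<le> inverse (Suc n)" for i j n
  proof -
    have "\<bar>W n i j - W n j i\<bar> \<le> (1::real) * card (outer_vertex_boundary C (E \<inter> C \<times> C) (S n))"
      unfolding W_def s_def
      by (rule symmetric_flow_imbalance[where F = "\<lambda>x y. f (x, y)", OF E S(2,1) closed fin]) (use f f1 in auto)
    then have "\<bar>W n i j - W n j i\<bar> / N n \<le> card (outer_vertex_boundary C (E \<inter> C \<times> C) (S n)) / N n"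
      using N[of n] by (simp add: divide_right_mono)
    with small[of n] N[of n] show ?thesis
      by (simp add: w_def diff_divide_distrib[symmetric])
  qed
  have p_swap: "\<bar>d i j * p i n - d j i * p j n\<bar> \<le> D * inverse (Suc n)" for i j n
  proof -
    have eq: "(\<Sum>x\<in>{x \<in> S n. \<kappa> x = i}. \<Sum>y\<in>{y \<in> neighbours E x. \<kappa> y = j}. 1) = real (d i j) * card (s n i)" for i j
    proof -
      have "(\<Sum>x\<in>{x \<in> S n. \<kappa> x = i}. \<Sum>y\<in>{y \<in> neighbours E x. \<kappa> y = j}. 1) = (\<Sum>x\<in>s n i. real (d i j))"
        using d sC by (intro sum.cong) (auto simp: s_def)
      then show ?thesis by (simp add: mult.commute)
    qed
    have "\<bar>real (d i j) * card (s n i) - real (d j i) * card (s n j)\<bar> \<le>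
        D * card (outer_vertex_boundary C (E \<inter> C \<times> C) (S n))"
      unfolding eq[symmetric]
      by (rule symmetric_flow_imbalance[where F = "\<lambda>_ _. 1", OF E S(2,1) closed fin]) (use deg in auto)
    then have "\<bar>real (d i j) * card (s n i) - real (d j i) * card (s n j)\<bar> / N n \<le>
        D * (card (outer_vertex_boundary C (E \<inter> C \<times> C) (S n)) / N n)"
      using N[of n] by (simp add: divide_right_mono)
    also have "\<dots> \<le> D * inverse (Suc n)"
      using small[of n] by (intro mult_left_mono) (auto simp: D_def sum_nonneg)
    finally show ?thesis
      using N[of n] by (simp add: p_def diff_divide_distrib[symmetric])
  qed
  have "\<exists>\<sigma> :: nat \<Rightarrow> nat. strict_mono \<sigma> \<and> (\<forall>k\<in>?I \<times> ?I. convergent (w k \<circ> \<sigma>))"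
  proof (rule finite_family_convergent_subseq)
    fix k assume "k \<in> ?I \<times> ?I"
    then obtain i j where k: "k = (i, j)" "i \<in> ?I" "j \<in> ?I" by auto
    have "\<bar>w k n\<bar> \<le> 1" for n
    proof -
      have "W n i j \<le> (\<Sum>j\<in>?I. W n i j)" using k colors W_nonneg by (intro member_le_sum) auto
      also have "\<dots> \<le> N n"
        unfolding W_sum N_def s_def using S(2) by (simp add: card_mono)
      finally show ?thesis using N[of n] W_nonneg[of n i j] by (simp add: w_def k)
    qed
    then show "bounded (range (w k))" by (auto simp: bounded_iff)
  qed (use colors in auto)
  then obtain \<sigma> where \<sigma>: "strict_mono \<sigma>" "\<And>i j. i \<in> ?I \<Longrightarrow> j \<in> ?I \<Longrightarrow> convergent (w (i, j) \<circ> \<sigma>)" by blast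
  define \<omega> where "\<omega> i j = lim (w (i, j) \<circ> \<sigma>)" for i j
  have \<omega>: "(\<lambda>n. w (i, j) (\<sigma> n)) \<longlonglongrightarrow> \<omega> i j" if "i \<in> ?I" "j \<in> ?I" for i j
    using \<sigma>(2)[OF that] unfolding \<omega>_def by (simp add: convergent_LIMSEQ_iff comp_def)
  \<comment> \<open>This is the limiting share of colour \<open>i\<close>. Since \<open>f\<close>
    sums to \<open>1\<close> at each vertex, shares are row sums of \<open>w\<close>, so their
    convergence follows from that of \<open>w\<close>.\<close>
  define P where "P i = (\<Sum>j\<in>?I. \<omega> i j)" for i
  have p_w: "p i n = (\<Sum>j\<in>?I. w (i, j) n)" for i n
    unfolding p_def w_def using W_sum[of n i] by (simp add: sum_divide_distrib[symmetric])
  have P: "(\<lambda>n. p i (\<sigma> n)) \<longlonglongrightarrow> P i" if "i \<in> ?I" for i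
    unfolding p_w P_def using that by (intro tendsto_sum \<omega>)
  have vanish: "(\<lambda>n. inverse (real (Suc (\<sigma> n)))) \<longlonglongrightarrow> 0"
    using LIMSEQ_subseq_LIMSEQ[OF LIMSEQ_inverse_real_of_nat \<sigma>(1)] by (simp add: comp_def)
  have \<omega>_swap: "\<omega> i j = \<omega> j i" if "i \<in> ?I" "j \<in> ?I" for i j
  proof -
    have "(\<lambda>n. w (i, j) (\<sigma> n) - w (j, i) (\<sigma> n)) \<longlonglongrightarrow> 0"
      using w_swap by (intro Lim_null_comparison[OF _ vanish] always_eventually) auto
    moreover have "(\<lambda>n. w (i, j) (\<sigma> n) - w (j, i) (\<sigma> n)) \<longlonglongrightarrow> \<omega> i j - \<omega> j i"
      using that by (intro tendsto_diff \<omega>)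
    ultimately show ?thesis using LIMSEQ_unique by fastforce
  qed
  have P_swap: "d i j * P i = d j i * P j" if "i \<in> ?I" "j \<in> ?I" for i j
  proof -
    have "(\<lambda>n. D * inverse (real (Suc (\<sigma> n)))) \<longlonglongrightarrow> 0"
      using tendsto_mult_right_zero[OF vanish] .
    then have "(\<lambda>n. d i j * p i (\<sigma> n) - d j i * p j (\<sigma> n)) \<longlonglongrightarrow> 0"
      by (rule Lim_null_comparison[rotated]) (use p_swap in \<open>auto intro!: always_eventually\<close>)
    moreover have "(\<lambda>n. d i j * p i (\<sigma> n) - d j i * p j (\<sigma> n)) \<longlonglongrightarrow> d i j * P i - d j i * P j"
      using that by (intro tendsto_diff tendsto_mult tendsto_const P)
    ultimately show ?thesis using LIMSEQ_unique by fastforce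
  qed
  have P_sum: "(\<Sum>i\<in>?I. P i) = 1"
  proof -
    have "(\<lambda>n. \<Sum>i\<in>?I. p i (\<sigma> n)) \<longlonglongrightarrow> (\<Sum>i\<in>?I. P i)" by (intro tendsto_sum P)
    then show ?thesis unfolding p_sum by (simp add: LIMSEQ_const_iff)
  qed
  have \<omega>_nonneg: "0 \<le> \<omega> i j" if "i \<in> ?I" "j \<in> ?I" for i j
    using \<omega>[OF that] by (rule LIMSEQ_le_const) (use W_nonneg N in \<open>auto simp: w_def less_imp_le\<close>)
  have \<omega>_le: "\<omega> i j \<le> d i j * P i" if "i \<in> ?I" "j \<in> ?I" for i j
  proof (rule LIMSEQ_le[OF \<omega>[OF that]])
    show "(\<lambda>n. d i j * p i (\<sigma> n)) \<longlonglongrightarrow> d i j * P i" using that by (intro tendsto_mult tendsto_const P)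
    have "w (i, j) n \<le> d i j * p i n" for n
      using W_le[of n i j] N[of n] by (simp add: w_def p_def divide_right_mono)
    then show "\<exists>N. \<forall>n\<ge>N. w (i, j) (\<sigma> n) \<le> d i j * p i (\<sigma> n)" by blast
  qed
  have P_nonneg: "0 \<le> P i" if "i \<in> ?I" for i
    unfolding P_def using that \<omega>_nonneg by (intro sum_nonneg) auto
  \<comment> \<open>Some share is positive as they sum to \<open>1\<close>, and
    \<open>P_swap\<close> carries positivity along each edge of the connected set
    \<open>C\<close>.\<close>
  have P_pos: "P (\<kappa> y) > 0" if y: "y \<in> C" for y
  proof -
    have "\<exists>i\<in>?I. P i \<noteq> 0" using P_sum by (metis sum.neutral zero_neq_one)
    then obtain x where x: "x \<in> C" "P (\<kappa> x) > 0" using P_nonneg by force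
    from conn[OF x(1) y] have "y \<in> C \<and> P (\<kappa> y) > 0"
    proof induction
      case base
      show ?case using x by simp
    next
      case (step y z)
      then have yz: "y \<in> C" "z \<in> C" using closed[of y] by (auto simp: neighbours_def)
      have "d (\<kappa> y) (\<kappa> z) > 0"
        unfolding d[OF yz(1), symmetric] using fin[OF yz(1)] step(2)
        by (auto simp: card_gt_0_iff neighbours_def)
      then have "d (\<kappa> z) (\<kappa> y) * P (\<kappa> z) > 0"
        using step P_swap[of "\<kappa> y" "\<kappa> z"] yz by (metis imageI mult_pos_pos of_nat_0_less_iff)
      then have "P (\<kappa> z) \<noteq> 0" by auto
      then show ?case using P_nonneg[of "\<kappa> z"] yz by auto
    qed
    then show ?thesis ..
  qed
  \<comment> \<open>If \<open>d i j = 0\<close>, division by zero gives \<open>0\<close>, in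
    accordance with \<open>\<omega> i j = 0\<close>.\<close>
  define g where "g i j = (if i \<in> ?I \<and> j \<in> ?I then \<omega> i j / (d i j * P i) else 0)" for i j
  have "0 \<le> g i j \<and> g i j \<le> 1 \<and> g i j = g j i" for i j
  proof (cases "i \<in> ?I \<and> j \<in> ?I")
    case True
    then show ?thesis
      using \<omega>_nonneg[of i j] \<omega>_le[of i j] \<omega>_swap[of i j] P_swap[of i j] P_nonneg[of i]
      by (auto simp: g_def divide_le_eq)
  qed (auto simp: g_def)
  moreover have "(\<Sum>y\<in>neighbours E x. g (\<kappa> x) (\<kappa> y)) = 1" if x: "x \<in> C" for x
  proof -
    have Px: "P (\<kappa> x) > 0" by (rule P_pos[OF x])
    have "(\<Sum>y\<in>neighbours E x. g (\<kappa> x) (\<kappa> y)) =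
      (\<Sum>j\<in>?I. \<Sum>y\<in>{y \<in> neighbours E x. \<kappa> y = j}. g (\<kappa> x) (\<kappa> y))"
      by (rule by_color[OF x])
    also have "\<dots> = (\<Sum>j\<in>?I. \<omega> (\<kappa> x) j / P (\<kappa> x))"
    proof (rule sum.cong[OF refl])
      fix j assume j: "j \<in> ?I"
      have "(\<Sum>y\<in>{y \<in> neighbours E x. \<kappa> y = j}. g (\<kappa> x) (\<kappa> y)) = d (\<kappa> x) j * g (\<kappa> x) j"
        using d[OF x, of j] by simp
      also have "\<dots> = \<omega> (\<kappa> x) j / P (\<kappa> x)"
      proof (cases "d (\<kappa> x) j = 0")
        case True
        then have "\<omega> (\<kappa> x) j = 0" using \<omega>_nonneg[of "\<kappa> x" j] \<omega>_le[of "\<kappa> x" j] x j by auto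
        with True show ?thesis by simp
      qed (use x j in \<open>auto simp: g_def\<close>)
      finally show "(\<Sum>y\<in>{y \<in> neighbours E x. \<kappa> y = j}. g (\<kappa> x) (\<kappa> y)) = \<omega> (\<kappa> x) j / P (\<kappa> x)" .
    qed
    also have "\<dots> = 1"
      using Px by (simp add: sum_divide_distrib[symmetric] P_def[symmetric])
    finally show ?thesis .
  qed
  ultimately show ?thesis by blast
qed

section \<open>Colour refinement\<close>

text \<open>Sorted lists represent multisets so that every colour is a natural number, comparable
  across components. The previous colour is stored too, so each stage refines the one
  before.\<close>

primrec refine_color :: "('a \<times> 'a) set \<Rightarrow> nat \<Rightarrow> 'a \<Rightarrow> nat" where
  "refine_color E 0 x = 0"
| "refine_color E (Suc r) x = to_nat (refine_color E r x,
     sorted_list_of_multiset (image_mset (refine_color E r) (mset_set (neighbours E x))))"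

lemma sorted_list_of_multiset_eq_iff:
  "sorted_list_of_multiset A = sorted_list_of_multiset B \<longleftrightarrow> A = B"
  by (metis mset_sorted_list_of_multiset)

lemma refine_color_Suc_eq_iff:
  "refine_color E (Suc r) x = refine_color E (Suc r) y \<longleftrightarrow>
     refine_color E r x = refine_color E r y \<and>
     image_mset (refine_color E r) (mset_set (neighbours E x)) =
     image_mset (refine_color E r) (mset_set (neighbours E y))"
  by (simp add: sorted_list_of_multiset_eq_iff)

text \<open>An automorphism maps the neighbours of \<open>x\<close> bijectively onto those of
  \<open>\<phi> x\<close>, so by induction the multisets of their colours agree.\<close>

lemma refine_color_automorphism:
  assumes closed: "\<And>x. x \<in> C \<Longrightarrow> neighbours E x \<subseteq> C"
    and \<phi>: "\<phi> \<in> graph_automorphisms C (E \<inter> C \<times> C)" and x: "x \<in> C"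
  shows "refine_color E r (\<phi> x) = refine_color E r x"
  using x
proof (induction r arbitrary: x)
  case (Suc r)
  have bij: "bij_betw \<phi> C C" using \<phi> by (simp add: graph_automorphisms_def Bij_def)
  have \<phi>C: "\<phi> y \<in> C" if "y \<in> C" for y using bij that by (auto simp: bij_betw_def)
  have adj: "(\<phi> y, \<phi> z) \<in> E \<longleftrightarrow> (y, z) \<in> E" if "y \<in> C" "z \<in> C" for y z
    using \<phi> that \<phi>C by (simp add: graph_automorphisms_def)
  have "neighbours E (\<phi> x) = \<phi> ` neighbours E x"
  proof (intro equalityI subsetI)
    fix z assume z: "z \<in> neighbours E (\<phi> x)"
    then have "z \<in> C" using closed[OF \<phi>C[OF Suc.prems]] by blast
    then obtain y where "y \<in> C" "z = \<phi> y" using bij by (auto simp: bij_betw_def)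
    with z adj[OF Suc.prems] show "z \<in> \<phi> ` neighbours E x" by (auto simp: neighbours_def)
  next
    fix z assume "z \<in> \<phi> ` neighbours E x"
    with closed[OF Suc.prems] adj[OF Suc.prems] show "z \<in> neighbours E (\<phi> x)"
      by (auto simp: neighbours_def)
  qed
  moreover have "inj_on \<phi> (neighbours E x)"
    using bij closed[OF Suc.prems] by (auto simp: bij_betw_def intro: inj_on_subset)
  ultimately have "image_mset (refine_color E r) (mset_set (neighbours E (\<phi> x))) =
      image_mset (\<lambda>y. refine_color E r (\<phi> y)) (mset_set (neighbours E x))"
    by (simp add: image_mset_mset_set[symmetric] multiset.map_comp comp_def)
  also have "\<dots> = image_mset (refine_color E r) (mset_set (neighbours E x))"
  proof (rule image_mset_cong)
    fix y assume "y \<in># mset_set (neighbours E x)"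
    \<comment> \<open>For an infinite neighbourhood \<open>mset_set\<close> is empty, so membership
      itself supplies finiteness.\<close>
    then have "y \<in> C" using closed[OF Suc.prems] by (metis elem_mset_set mset_set.infinite empty_iff set_mset_empty subsetD)
    then show "refine_color E r (\<phi> y) = refine_color E r y" by (rule Suc.IH)
  qed
  finally show ?case using Suc.IH[OF Suc.prems] by simp
qed simp

text \<open>Colours are constant on orbits. The bound is the same for every stage \<open>r\<close>,
  which is what forces the refinement to stabilise.\<close>

lemma card_refine_color_le_orbits:
  assumes closed: "\<And>x. x \<in> C \<Longrightarrow> neighbours E x \<subseteq> C"
    and qt: "quasi_transitive_graph C (E \<inter> C \<times> C)"
  shows "finite (refine_color E r ` C) \<and>
    card (refine_color E r ` C) \<le>
      card (orbits (graph_automorphism_group C (E \<inter> C \<times> C)) C (\<lambda>\<phi>. \<phi>))"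
proof -
  let ?G = "graph_automorphism_group C (E \<inter> C \<times> C)"
  let ?O = "orbits ?G C (\<lambda>\<phi>. \<phi>)"
  have fin: "finite ?O" using qt by (simp add: quasi_transitive_graph_def)
  interpret group_action ?G C "\<lambda>\<phi>. \<phi>" by (rule group_action_graph_automorphism_group)
  have sub: "refine_color E r ` C \<subseteq> (\<lambda>A. refine_color E r (SOME z. z \<in> A)) ` ?O"
  proof
    fix v assume "v \<in> refine_color E r ` C"
    then obtain x where x: "x \<in> C" "v = refine_color E r x" by blast
    let ?A = "orbit ?G (\<lambda>\<phi>. \<phi>) x"
    have "(SOME z. z \<in> ?A) \<in> ?A" using orbit_refl[OF x(1)] by (rule someI)
    then obtain \<phi> where "\<phi> \<in> graph_automorphisms C (E \<inter> C \<times> C)" "(SOME z. z \<in> ?A) = \<phi> x"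
      by (auto simp: orbit_def graph_automorphism_group_def)
    then have "refine_color E r (SOME z. z \<in> ?A) = v"
      using refine_color_automorphism[OF closed] x by simp
    moreover have "?A \<in> ?O" using x(1) by (auto simp: orbits_def)
    ultimately show "v \<in> (\<lambda>A. refine_color E r (SOME z. z \<in> A)) ` ?O" by blast
  qed
  then show ?thesis using fin surj_card_le finite_surj by metis
qed

text \<open>Every unstable stage strictly increases the number of colours. Were all stages unstable,
  stage \<open>m + 1\<close> would have more than \<open>m\<close> colours.\<close>

lemma refine_color_stabilises:
  assumes bound: "\<And>r. finite (refine_color E r ` C) \<and> card (refine_color E r ` C) \<le> m"
  obtains r where "\<And>x y. x \<in> C \<Longrightarrow> y \<in> C \<Longrightarrow> refine_color E r x = refine_color E r y \<Longrightarrow>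
    refine_color E (Suc r) x = refine_color E (Suc r) y"
proof -
  have step: "card (refine_color E r ` C) < card (refine_color E (Suc r) ` C)"
    if not: "\<not> (\<forall>x\<in>C. \<forall>y\<in>C. refine_color E r x = refine_color E r y \<longrightarrow>
      refine_color E (Suc r) x = refine_color E (Suc r) y)" for r
  proof -
    \<comment> \<open>\<open>pr\<close> forgets the last refinement. If the two stages have equally
      many colours, it is injective, and injectivity is stability.\<close>
    define pr :: "nat \<Rightarrow> nat" where "pr v = fst (from_nat v :: nat \<times> nat list)" for v
    have pr: "pr (refine_color E (Suc r) x) = refine_color E r x" for x by (simp add: pr_def)
    have im: "refine_color E r ` C = pr ` refine_color E (Suc r) ` C"
      unfolding image_image pr ..
    have fin: "finite (refine_color E (Suc r) ` C)" using bound by blast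
    have "card (pr ` refine_color E (Suc r) ` C) \<noteq> card (refine_color E (Suc r) ` C)"
    proof
      assume "card (pr ` refine_color E (Suc r) ` C) = card (refine_color E (Suc r) ` C)"
      then have inj: "inj_on pr (refine_color E (Suc r) ` C)" by (rule eq_card_imp_inj_on[OF fin])
      have "\<forall>x\<in>C. \<forall>y\<in>C. refine_color E r x = refine_color E r y \<longrightarrow>
        refine_color E (Suc r) x = refine_color E (Suc r) y"
      proof (intro ballI impI)
        fix x y assume "x \<in> C" "y \<in> C" "refine_color E r x = refine_color E r y"
        then show "refine_color E (Suc r) x = refine_color E (Suc r) y"
          using inj_onD[OF inj] pr by (metis imageI)
      qed
      with not show False ..
    qed
    moreover have "card (pr ` refine_color E (Suc r) ` C) \<le> card (refine_color E (Suc r) ` C)"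
      by (rule card_image_le[OF fin])
    ultimately show ?thesis unfolding im by linarith
  qed
  have "\<exists>r. \<forall>x\<in>C. \<forall>y\<in>C. refine_color E r x = refine_color E r y \<longrightarrow>
      refine_color E (Suc r) x = refine_color E (Suc r) y"
  proof (rule ccontr)
    assume "\<not> ?thesis"
    then have "card (refine_color E r ` C) < card (refine_color E (Suc r) ` C)" for r
      using step by blast
    then have "r \<le> card (refine_color E r ` C)" for r
      by (induction r) (simp, metis Suc_leI le_less_trans)
    then show False using bound[of "Suc m"] by (meson not_less_eq_eq order_trans)
  qed
  then show ?thesis using that by blast
qed

text \<open>
  The elements of \<open>T\<close> are colours of a stage \<open>r + 1\<close>, that is, codes of a colour of stage \<open>r\<close>
  together with the colours of the neighbours.
\<close>

definition color_matching :: "(nat \<Rightarrow> nat \<Rightarrow> real) \<Rightarrow> nat set \<Rightarrow> bool" where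
  "color_matching g T \<longleftrightarrow> (\<forall>i j. 0 \<le> g i j \<and> g i j \<le> 1 \<and> g i j = g j i) \<and>
     (\<forall>v\<in>T. case from_nat v of (i, js) \<Rightarrow> sum_list (map (g i) js) = 1)"

text \<open>A colour of stage \<open>r + 1\<close> lists the stage \<open>r\<close> colours of the
  neighbours, so the sum around a vertex is a function of that colour alone.\<close>

lemma color_matching_refine_color:
  "color_matching g (refine_color E (Suc r) ` C) \<longleftrightarrow>
     (\<forall>i j. 0 \<le> g i j \<and> g i j \<le> 1 \<and> g i j = g j i) \<and>
     (\<forall>x\<in>C. (\<Sum>y\<in>neighbours E x. g (refine_color E r x) (refine_color E r y)) = 1)"
proof -
  have "sum_list (map h (sorted_list_of_multiset (image_mset k (mset_set A)))) = (\<Sum>y\<in>A. h (k y))"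
    for h :: "nat \<Rightarrow> real" and k and A :: "'a set"
    by (simp add: sum_mset_sum_list[symmetric] sum_unfold_sum_mset multiset.map_comp comp_def)
  then show ?thesis by (simp add: color_matching_def)
qed

text \<open>At a stable stage the colour of a vertex determines the multiset of colours of its
  neighbours, which is the equitability that the averaging argument needs.\<close>

proposition ex_color_matching:
  assumes E: "sym E" and ne: "C \<noteq> {}"
    and closed: "\<And>x. x \<in> C \<Longrightarrow> neighbours E x \<subseteq> C"
    and conn: "\<And>x y. x \<in> C \<Longrightarrow> y \<in> C \<Longrightarrow> (x, y) \<in> E\<^sup>*"
    and fin: "\<And>x. x \<in> C \<Longrightarrow> finite (neighbours E x)"
    and f: "\<And>x y. x \<in> C \<Longrightarrow> (x, y) \<in> E \<Longrightarrow> 0 \<le> f (x, y) \<and> f (x, y) \<le> 1 \<and> f (x, y) = f (y, x)"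
    and f1: "\<And>x. x \<in> C \<Longrightarrow> (\<Sum>y\<in>neighbours E x. f (x, y)) = (1 :: real)"
    and qt: "quasi_transitive_graph C (E \<inter> C \<times> C)"
    and am: "amenable_graph C (E \<inter> C \<times> C)"
  shows "\<exists>r g. color_matching g (refine_color E (Suc r) ` C)"
proof -
  obtain r where r: "\<And>x y. x \<in> C \<Longrightarrow> y \<in> C \<Longrightarrow> refine_color E r x = refine_color E r y \<Longrightarrow>
    refine_color E (Suc r) x = refine_color E (Suc r) y"
    using refine_color_stabilises[OF card_refine_color_le_orbits[OF closed qt]] by blast
  let ?\<kappa> = "refine_color E r"
  \<comment> \<open>The count is taken at a chosen representative of colour \<open>i\<close>;
    stability makes it the same for every vertex of that colour.\<close>
  define d where "d i j = card {y \<in> neighbours E (SOME z. z \<in> C \<and> ?\<kappa> z = i). ?\<kappa> y = j}" for i j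
  have d: "card {y \<in> neighbours E x. ?\<kappa> y = j} = d (?\<kappa> x) j" if x: "x \<in> C" for x j
  proof -
    define z where "z = (SOME z. z \<in> C \<and> ?\<kappa> z = ?\<kappa> x)"
    have z: "z \<in> C \<and> ?\<kappa> z = ?\<kappa> x" unfolding z_def by (rule someI[of _ x]) (simp add: x)
    then have "refine_color E (Suc r) z = refine_color E (Suc r) x" using r x by blast
    then have "image_mset ?\<kappa> (mset_set (neighbours E z)) = image_mset ?\<kappa> (mset_set (neighbours E x))"
      unfolding refine_color_Suc_eq_iff by blast
    moreover have "count (image_mset ?\<kappa> (mset_set (neighbours E y))) j =
        card {u \<in> neighbours E y. ?\<kappa> u = j}" if "y \<in> C" for y
      using fin[OF that] by (rule count_image_mset_eq_card_vimage)
    ultimately show ?thesis using x z unfolding d_def z_def[symmetric] by metis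
  qed
  have Folner: "\<exists>S. S \<subseteq> C \<and> finite S \<and> S \<noteq> {} \<and>
      card (outer_vertex_boundary C (E \<inter> C \<times> C) S) < e * card S" if e: "e > 0" for e :: real
  proof -
    let ?\<S> = "{S. S \<subseteq> C \<and> finite S \<and> S \<noteq> {} \<and> connected_vertex_set (E \<inter> C \<times> C) S}"
    let ?q = "\<lambda>S. real (card (outer_vertex_boundary C (E \<inter> C \<times> C) S)) / real (card S)"
    obtain x where "x \<in> C" using ne by blast
    then have "{x} \<in> ?\<S>" by (simp add: connected_vertex_set_def)
    \<comment> \<open>Otherwise \<open>e\<close> would be a lower bound of the ratios, contradicting
      the infimum \<open>0\<close>; the singleton shows that the family is nonempty.\<close>
    have "\<exists>S\<in>?\<S>. ?q S < e"
    proof (rule ccontr)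
      assume "\<not> ?thesis"
      then have "e \<le> (INF S\<in>?\<S>. ?q S)"
        using \<open>{x} \<in> ?\<S>\<close> by (intro cINF_greatest) (auto simp: not_less)
      with am e show False unfolding amenable_graph_def by linarith
    qed
    then obtain S where "S \<in> ?\<S>" "?q S < e" by blast
    moreover from this have "card S > 0" by (simp add: card_gt_0_iff)
    ultimately show ?thesis by (intro exI[of _ S]) (simp add: divide_less_eq)
  qed
  have colors: "finite (?\<kappa> ` C)" using card_refine_color_le_orbits[OF closed qt] by blast
  show ?thesis
    using amenable_equitable_fractional_matching[OF E ne closed conn fin f f1 Folner colors d]
    unfolding color_matching_refine_color by blast
qed

section \<open>Measurability of refined colours and of saturations\<close>

locale standard_borel_graph =
  fixes X :: "'a measure" and E :: "('a \<times> 'a) set"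
  assumes standard: "standard_borel_space X"
    and sets_E: "E \<in> sets (X \<Otimes>\<^sub>M X)"
    and finite_neighbours: "x \<in> space X \<Longrightarrow> finite (neighbours E x)"
begin

lemma E_subset: "E \<subseteq> space X \<times> space X"
  using sets.sets_into_space[OF sets_E] by (simp add: space_pair_measure)

lemma neighbours_subset: "neighbours E x \<subseteq> space X"
  using E_subset by (auto simp: neighbours_def)

lemma measurable_card_neighbours:
  "A \<in> sets X \<Longrightarrow> {x \<in> space X. card (neighbours E x \<inter> A) = k} \<in> sets X"
  by (rule sets_card_neighbours[OF standard sets_E finite_neighbours])

text \<open>By induction, a colour class of stage \<open>r + 1\<close> is cut out by countably many
  conditions on the numbers of neighbours in the Borel colour classes of stage
  \<open>r\<close>.\<close>

lemma measurable_refine_color [measurable]: "refine_color E r \<in> X \<rightarrow>\<^sub>M count_space UNIV"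
proof (induction r)
  case (Suc r)
  have level: "{x \<in> space X. refine_color E r x = i} \<in> sets X" for i
    using measurable_sets[OF Suc.IH, of "{i}"] by (simp add: vimage_def Int_def conj_commute)
  have "{x \<in> space X. refine_color E (Suc r) x = v} \<in> sets X" for v
  proof (cases "\<exists>i js. v = to_nat (i :: nat, sorted_list_of_multiset (js :: nat multiset))")
    case True
    then obtain i js where v: "v = to_nat (i :: nat, sorted_list_of_multiset (js :: nat multiset))" by blast
    have "refine_color E (Suc r) x = v \<longleftrightarrow> refine_color E r x = i \<and>
        (\<forall>j. card (neighbours E x \<inter> {y \<in> space X. refine_color E r y = j}) = count js j)"
      if "x \<in> space X" for x
    proof -
      have "count (image_mset (refine_color E r) (mset_set (neighbours E x))) j =
          card (neighbours E x \<inter> {y \<in> space X. refine_color E r y = j})" for j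
      proof -
        have "{u \<in> neighbours E x. refine_color E r u = j} =
            neighbours E x \<inter> {y \<in> space X. refine_color E r y = j}"
          using neighbours_subset[of x] by auto
        then show ?thesis
          using count_image_mset_eq_card_vimage[OF finite_neighbours[OF that]] by metis
      qed
      moreover have "refine_color E (Suc r) x = v \<longleftrightarrow> refine_color E r x = i \<and>
          image_mset (refine_color E r) (mset_set (neighbours E x)) = js"
        unfolding v by (simp add: sorted_list_of_multiset_eq_iff)
      ultimately show ?thesis by (simp add: multiset_eq_iff)
    qed
    then have "{x \<in> space X. refine_color E (Suc r) x = v} = {x \<in> space X. refine_color E r x = i} \<inter>
      (\<Inter>j. {x \<in> space X. card (neighbours E x \<inter> {y \<in> space X. refine_color E r y = j}) = count js j})"
      by auto
    also have "\<dots> \<in> sets X"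
      by (intro sets.Int sets.countable_INT level) (auto intro: measurable_card_neighbours level)
    finally show ?thesis .
  next
    case False
    then have "{x \<in> space X. refine_color E (Suc r) x = v} = {}" by auto
    then show ?thesis by (simp only: sets.empty_sets)
  qed
  then show ?case
    by (subst measurable_count_space_eq2_countable) (auto simp: vimage_def Int_def conj_commute)
qed simp

text \<open>Reaching \<open>A\<close> in \<open>n + 1\<close> steps means having a nonzero number of
  neighbours that reach it in \<open>n\<close> steps, so the counting lemma applies at each
  length.\<close>

lemma sets_saturation:
  assumes A: "A \<in> sets X"
  shows "{x \<in> space X. \<exists>z\<in>graph_component E x. z \<in> A} \<in> sets X"
proof -
  have pow: "{x \<in> space X. \<exists>z\<in>A. (x, z) \<in> E ^^ n} \<in> sets X" for n
  proof (induction n)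
    case 0
    have "{x \<in> space X. \<exists>z\<in>A. (x, z) \<in> E ^^ 0} = A" using sets.sets_into_space[OF A] by auto
    with A show ?case by (simp only:)
  next
    case (Suc n)
    let ?S = "{x \<in> space X. \<exists>z\<in>A. (x, z) \<in> E ^^ n}"
    have "{x \<in> space X. \<exists>z\<in>A. (x, z) \<in> E ^^ Suc n} =
        space X - {x \<in> space X. card (neighbours E x \<inter> ?S) = 0}"
    proof (rule Set.set_eqI)
      fix x
      have "(\<exists>z\<in>A. (x, z) \<in> E ^^ Suc n) \<longleftrightarrow> neighbours E x \<inter> ?S \<noteq> {}"
        using E_subset by (fastforce simp: neighbours_def elim: relpow_Suc_E2 intro: relpow_Suc_I2)
      then show "x \<in> {x \<in> space X. \<exists>z\<in>A. (x, z) \<in> E ^^ Suc n} \<longleftrightarrow>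
          x \<in> space X - {x \<in> space X. card (neighbours E x \<inter> ?S) = 0}"
        using finite_neighbours[of x] by (auto simp: card_eq_0_iff)
    qed
    with measurable_card_neighbours[OF Suc.IH, of 0] show ?case by (simp only: sets.compl_sets)
  qed
  have "{x \<in> space X. \<exists>z\<in>graph_component E x. z \<in> A} =
      (\<Union>n. {x \<in> space X. \<exists>z\<in>A. (x, z) \<in> E ^^ n})"
    by (auto simp: graph_component_def rtrancl_power)
  with pow show ?thesis by simp
qed

end

section \<open>The Borel matching determined by the colours of each component\<close>

context standard_borel_graph
begin

lemma graph_component_subset: "x \<in> space X \<Longrightarrow> graph_component E x \<subseteq> space X"
proof
  fix z assume x: "x \<in> space X" and "z \<in> graph_component E x"
  then have "(x, z) \<in> E\<^sup>*" by (simp add: graph_component_def)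
  then show "z \<in> space X" using x E_subset by induction auto
qed

text \<open>The stage is \<open>r + 1\<close> because \<open>color_matching\<close> decodes
  neighbour lists of stage \<open>r\<close> from these colours.\<close>

definition component_colors :: "nat \<Rightarrow> 'a \<Rightarrow> nat set" where
  "component_colors r x = refine_color E (Suc r) ` graph_component E x"

text \<open>A colour belongs to the set exactly when \<open>x\<close> is in the saturation of its
  colour class. There are countably many finite sets, so it suffices that each fibre is
  Borel.\<close>

lemma measurable_component_colors:
  assumes fin: "\<And>x. x \<in> space X \<Longrightarrow> finite (component_colors r x)"
  shows "component_colors r \<in> X \<rightarrow>\<^sub>M count_space {T. finite T}"
proof -
  have "component_colors r -` {T} \<inter> space X \<in> sets X" for T
  proof -
    let ?A = "\<lambda>v. {z \<in> space X. refine_color E (Suc r) z = v}"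
    have A: "?A v \<in> sets X" for v
      using measurable_sets[OF measurable_refine_color, of "{v}" "Suc r"]
      by (simp only: vimage_def Int_def mem_Collect_eq singleton_iff conj_commute sets_count_space UNIV_I
          Pow_UNIV)
    have mem: "v \<in> component_colors r x \<longleftrightarrow> (\<exists>z\<in>graph_component E x. z \<in> ?A v)"
      if "x \<in> space X" for x v
      using graph_component_subset[OF that] unfolding component_colors_def by blast
    have "component_colors r -` {T} \<inter> space X =
      {x \<in> space X. \<forall>v. (\<exists>z\<in>graph_component E x. z \<in> ?A v) \<longleftrightarrow> v \<in> T}"
    proof (rule Set.set_eqI)
      fix x show "x \<in> component_colors r -` {T} \<inter> space X \<longleftrightarrow>
          x \<in> {x \<in> space X. \<forall>v. (\<exists>z\<in>graph_component E x. z \<in> ?A v) \<longleftrightarrow> v \<in> T}"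
      proof (cases "x \<in> space X")
        case True
        have "component_colors r x = T \<longleftrightarrow> (\<forall>v. v \<in> component_colors r x \<longleftrightarrow> v \<in> T)" by blast
        then show ?thesis using True mem[OF True] by simp
      qed simp
    qed
    also have "\<dots> \<in> sets X"
    proof -
      have [measurable]: "Measurable.pred X (\<lambda>x. \<exists>z\<in>graph_component E x. z \<in> ?A v)" for v
        using sets_saturation[OF A[of v]] by (simp only: pred_def)
      show ?thesis by measurable
    qed
    finally show ?thesis .
  qed
  then show ?thesis
    using fin by (subst measurable_count_space_eq_countable) (auto simp: countable_Collect_finite)
qed

definition matching_level :: "'a \<Rightarrow> nat" where
  "matching_level x = (LEAST r. \<exists>g. color_matching g (component_colors r x))"

text \<open>The choice is made once per set of colours rather than per component, so only countably
  many choices occur on finite sets and measurability survives.\<close>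

definition matching_weight :: "nat set \<Rightarrow> nat \<Rightarrow> nat \<Rightarrow> real" where
  "matching_weight T = (SOME g. color_matching g T)"

definition color_fractional_matching :: "'a \<times> 'a \<Rightarrow> real" where
  "color_fractional_matching p =
     (let r = matching_level (fst p)
      in matching_weight (component_colors r (fst p)) (refine_color E r (fst p)) (refine_color E r (snd p)))"

text \<open>Once the level and the set of colours are fixed, the value is a function of two
  measurable colours; both parameters range over countable sets.\<close>

lemma measurable_color_fractional_matching:
  assumes fin: "\<And>r x. x \<in> space X \<Longrightarrow> finite (component_colors r x)"
  shows "color_fractional_matching \<in> borel_measurable (X \<Otimes>\<^sub>M X)"
proof -
  have level: "matching_level \<in> X \<rightarrow>\<^sub>M count_space UNIV"
    unfolding matching_level_def
  proof (rule measurable_Least)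
    fix r
    have "(\<lambda>T. \<exists>g. color_matching g T) \<in> count_space {T. finite T} \<rightarrow>\<^sub>M count_space UNIV" by simp
    from measurable_compose[OF measurable_component_colors[OF fin] this]
    show "(\<lambda>x. \<exists>g. color_matching g (component_colors r x)) \<in> X \<rightarrow>\<^sub>M count_space UNIV" .
  qed
  have "(\<lambda>p. matching_weight (component_colors r (fst p)) (refine_color E r (fst p)) (refine_color E r (snd p)))
      \<in> borel_measurable (X \<Otimes>\<^sub>M X)" for r
  proof (rule measurable_compose_countable'[where I = "{T. finite T}"
        and g = "\<lambda>p. component_colors r (fst p)"
        and f = "\<lambda>T p. matching_weight T (refine_color E r (fst p)) (refine_color E r (snd p))"])
    show "(\<lambda>p. component_colors r (fst p)) \<in> X \<Otimes>\<^sub>M X \<rightarrow>\<^sub>M count_space {T. finite T}"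
      by (rule measurable_compose[OF measurable_fst measurable_component_colors[OF fin]])
    show "countable {T :: nat set. finite T}" by (rule countable_Collect_finite)
    fix T :: "nat set"
    have s: "(\<lambda>p. refine_color E r (snd p)) \<in> X \<Otimes>\<^sub>M X \<rightarrow>\<^sub>M count_space UNIV"
      and f: "(\<lambda>p. refine_color E r (fst p)) \<in> X \<Otimes>\<^sub>M X \<rightarrow>\<^sub>M count_space UNIV"
      by measurable
    show "(\<lambda>p. matching_weight T (refine_color E r (fst p)) (refine_color E r (snd p)))
        \<in> borel_measurable (X \<Otimes>\<^sub>M X)"
      by (rule measurable_compose_countable[OF measurable_compose[OF s] f]) simp
  qed
  moreover have "(\<lambda>p. matching_level (fst p)) \<in> X \<Otimes>\<^sub>M X \<rightarrow>\<^sub>M count_space UNIV"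
    by (rule measurable_compose[OF measurable_fst level])
  ultimately show ?thesis
    unfolding color_fractional_matching_def Let_def by (rule measurable_compose_countable)
qed

text \<open>Level and weight depend only on the component, hence agree at both ends of an edge.
  Symmetry of the weight then gives symmetry of the matching.\<close>

lemma color_fractional_matching_perfect:
  assumes E: "sym E"
    and ex: "\<And>x. x \<in> space X \<Longrightarrow> \<exists>r g. color_matching g (component_colors r x)"
  shows "fractional_perfect_matching (space X) E color_fractional_matching"
proof -
  define h where "h x = matching_weight (component_colors (matching_level x) x)" for x
  have h: "color_matching (h x) (component_colors (matching_level x) x)" if "x \<in> space X" for x
  proof -
    have "\<exists>g. color_matching g (component_colors (matching_level x) x)"
      unfolding matching_level_def by (rule LeastI_ex) (rule ex[OF that])
    then show ?thesis unfolding h_def matching_weight_def by (rule someI_ex)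
  qed
  have F: "color_fractional_matching (x, y) =
      h x (refine_color E (matching_level x) x) (refine_color E (matching_level x) y)" for x y
    by (simp add: color_fractional_matching_def h_def Let_def)
  have comp: "graph_component E x = graph_component E y" if "(x, y) \<in> E" for x y
    using that symD[OF E that] unfolding graph_component_def
    by (auto intro: converse_rtrancl_into_rtrancl)
  have lev: "matching_level x = matching_level y" "h x = h y" if "(x, y) \<in> E" for x y
    using comp[OF that] by (simp_all add: matching_level_def h_def component_colors_def)
  have g: "0 \<le> h x i j \<and> h x i j \<le> 1 \<and> h x i j = h x j i" if "x \<in> space X" for x i j
    using h[OF that] unfolding color_matching_def by blast
  show ?thesis
    unfolding fractional_perfect_matching_def
  proof (intro conjI ballI)
    show "color_fractional_matching \<in> E \<rightarrow> {0..1}"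
      using E_subset g by (auto simp: F)
    show "case p of (x, y) \<Rightarrow> color_fractional_matching (x, y) = color_fractional_matching (y, x)"
      if "p \<in> E" for p
    proof -
      obtain x y where p: "p = (x, y)" by fastforce
      then have "(x, y) \<in> E" "x \<in> space X" using that E_subset by auto
      then show ?thesis using lev[of x y] g[of x] unfolding p by (simp add: F)
    qed
    show "(\<Sum>y\<in>neighbours E x. color_fractional_matching (x, y)) = 1" if x: "x \<in> space X" for x
    proof -
      have "x \<in> graph_component E x" by (simp add: graph_component_def)
      then show ?thesis
        using h[OF x] unfolding component_colors_def color_matching_refine_color F by blast
    qed
  qed
qed

end

theorem theorem1p1:
  fixes X :: "'a measure" and E :: "('a \<times> 'a) set"
  assumes "standard_borel_space X"
    and "borel_graph X E"
    and "locally_finite_graph (space X) E"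
    and "\<forall>C \<in> graph_component E ` space X.
           quasi_transitive_graph C (E \<inter> C \<times> C) \<and> amenable_graph C (E \<inter> C \<times> C)"
    and "\<exists>f. fractional_perfect_matching (space X) E f"
  shows "\<exists>f. borel_fractional_perfect_matching X E f"
proof -
  have E: "sym E" using assms(2) by (simp add: borel_graph_def)
  interpret standard_borel_graph X E
    using assms(1-3) by unfold_locales (auto simp: borel_graph_def locally_finite_graph_def)
  obtain f where f: "fractional_perfect_matching (space X) E f" using assms(5) by blast
  have closed: "neighbours E y \<subseteq> graph_component E x" if "y \<in> graph_component E x" for x y
    using that by (auto simp: graph_component_def neighbours_def)
  \<comment> \<open>Quasi-transitivity bounds the number of colours, which places the colour sets in
    the countable family of finite sets.\<close>
  have fin: "finite (component_colors r x)" if "x \<in> space X" for r x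
    using card_refine_color_le_orbits[OF closed, of x "Suc r"] assms(4) that
    unfolding component_colors_def by blast
  have ex: "\<exists>r g. color_matching g (component_colors r x)" if x: "x \<in> space X" for x
    unfolding component_colors_def
  proof (rule ex_color_matching[OF E _ closed])
    show "graph_component E x \<noteq> {}" by (auto simp: graph_component_def)
    show "quasi_transitive_graph (graph_component E x) (E \<inter> graph_component E x \<times> graph_component E x)"
      "amenable_graph (graph_component E x) (E \<inter> graph_component E x \<times> graph_component E x)"
      using assms(4) x by auto
    fix y assume y: "y \<in> graph_component E x"
    then have yX: "y \<in> space X" using graph_component_subset[OF x] by blast
    then show "finite (neighbours E y)" by (rule finite_neighbours)
    show "(\<Sum>z\<in>neighbours E y. f (y, z)) = 1"
      using f yX unfolding fractional_perfect_matching_def by blast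
    show "(y, z) \<in> E\<^sup>*" if "z \<in> graph_component E x" for z
    proof -
      have "(y, x) \<in> E\<^sup>*" using y sym_rtrancl[OF E] by (auto simp: graph_component_def dest: symD)
      then show ?thesis using that by (auto simp: graph_component_def)
    qed
    show "0 \<le> f (y, z) \<and> f (y, z) \<le> 1 \<and> f (y, z) = f (z, y)" if "(y, z) \<in> E" for z
      using f that unfolding fractional_perfect_matching_def by fastforce
  qed
  have "borel_fractional_perfect_matching X E color_fractional_matching"
    unfolding borel_fractional_perfect_matching_def
    using color_fractional_matching_perfect[OF E ex]
      measurable_restrict_space1[OF measurable_color_fractional_matching[OF fin]] by blast
  then show ?thesis by (rule exI[of _ color_fractional_matching])
qed

end
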